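(* Let $M,N,Q,H$ be real numbers satisfying the BPS condition $M^2+N^2=Q^2+H^2=:Z^2$ with $Z>0$, and consider the charged Taub-NUT background (on the region $r>\max(M,0)$, $0<\theta<\pi$) $$ds^2=-\frac{\lambda}{R^2}(dt+2N\cos\theta\,d\phi)^2+\frac{R^2}{\lambda}dr^2+R^2(d\theta^2+\sin^2\theta\,d\phi^2),$$ $$A=\frac{Qr+NH}{R^2}\,dt+\frac{-H(r^2-N^2)+2NQr}{R^2}\cos\theta\,d\phi,$$ with $\lambda=r^2-N^2-2Mr+Z^2$, $R^2=r^2+N^2$. Then this background is half-BPS in $\mathcal N=2$ supergravity: for every constant $\epsilon_0\in\mathbb C^4$ the spinor $$\epsilon=e^{\frac12\gamma_{12}\theta}\,e^{\frac12\gamma_{23}\phi}\,\sqrt{\frac{r-M}{R}}\;e^{\frac{\beta(r)}2\gamma_5}\;\frac12\left(e^{\alpha_m\gamma_5}+i\,e^{-\alpha_q\gamma_5}\gamma_0\right)\epsilon_0$$ satisfies the Killing spinor equation $$\nabla_\mu\epsilon=\Big(\partial_\mu+\tfrac14\omega_\mu{}^{ab}\gamma_{ab}+\tfrac i4F_{ab}\gamma^{ab}\gamma_\mu\Big)\epsilon=0 ,$$ and the Killing spinors so obtained depend on two independent complex constants, i.e. the space of Killing spinors has complex dimension two (four of the eight real supersymmetries are preserved).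
   Context: Signature $(-,+,+,+)$. The vielbein is $e^0=\frac{\sqrt\lambda}{R}(dt+2N\cos\theta\,d\phi)$, $e^1=\frac{R}{\sqrt\lambda}dr$, $e^2=R\,d\theta$, $e^3=R\sin\theta\,d\phi$; flat indices $a,b$ are moved with $\eta_{ab}=\mathrm{diag}(-1,1,1,1)$. $\omega^{ab}=\omega_\mu{}^{ab}dx^\mu$ is the torsion-free spin connection, $de^a+\omega^a{}_b\wedge e^b=0$. $F=dA$, with flat components $F_{ab}$ defined by $F=\frac12F_{ab}\,e^a\wedge e^b$. The gamma matrices $\gamma_a$ are real $4\times4$ matrices with $\gamma_a\gamma_b+\gamma_b\gamma_a=2\eta_{ab}$, $\gamma_{ab}=\frac12(\gamma_a\gamma_b-\gamma_b\gamma_a)$, $\gamma_\mu=e^a{}_\mu\gamma_a$, and $\gamma_5=\gamma_0\gamma_1\gamma_2\gamma_3$, so $\gamma_5^2=-1$. The angles $\beta(r),\alpha_m,\alpha_q$ are defined by $$r+\gamma_5N=R\,e^{\beta(r)\gamma_5},\qquad M+\gamma_5N=\sqrt{M^2+N^2}\,e^{\alpha_m\gamma_5},\qquad Q+\gamma_5H=Z\,e^{\alpha_q\gamma_5},$$ i.e. $\cos\beta=r/R$, $\sin\beta=N/R$, etc. (with $\beta(r)$ the continuous branch in $(-\pi/2,\pi/2)$). Under the BPS condition, $\lambda=(r-M)^2$. *)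

theory Defs
  imports "HOL-Analysis.Analysis" "HOL-Library.Function_Algebras"
begin

text \<open>
  Both the coordinates and the flat frame are indexed by the four-element type \<open>4\<close>, whose elements
  are \<open>0, 1, 2, 3\<close>. A point \<open>x :: real^4\<close> has coordinates
  \<open>t = x $ 0\<close>, \<open>r = x $ 1\<close>, \<open>\<theta> = x $ 2\<close>, \<open>\<phi> = x $ 3\<close>. A one-form at a point is the vector of its
  coordinate components, so that \<open>axis \<mu> 1\<close> is \<open>dx\<^sup>\<mu>\<close>; a two-form is the antisymmetric
  array of its coordinate components.
\<close>

definition eta :: "4 \<Rightarrow> 4 \<Rightarrow> real" where
  "eta a b = (if a = b then (if a = 0 then -1 else 1) else 0)"

section \<open>Frames, spin connection and field strength\<close>

definition partial_deriv :: "4 \<Rightarrow> (real^4 \<Rightarrow> 'v::real_normed_vector) \<Rightarrow> real^4 \<Rightarrow> 'v" where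
  "partial_deriv \<mu> f x = frechet_derivative f (at x) (axis \<mu> 1)"

definition wedge :: "real^4 \<Rightarrow> real^4 \<Rightarrow> 4 \<Rightarrow> 4 \<Rightarrow> real" where
  "wedge \<alpha> \<beta> \<mu> \<nu> = \<alpha> $ \<mu> * \<beta> $ \<nu> - \<alpha> $ \<nu> * \<beta> $ \<mu>"

definition ext_deriv :: "(real^4 \<Rightarrow> real^4) \<Rightarrow> real^4 \<Rightarrow> 4 \<Rightarrow> 4 \<Rightarrow> real" where
  "ext_deriv \<alpha> x \<mu> \<nu> =
     partial_deriv \<mu> (\<lambda>y. \<alpha> y $ \<nu>) x - partial_deriv \<nu> (\<lambda>y. \<alpha> y $ \<mu>) x"

text \<open>
  A coframe \<open>e\<close> is given by \<open>e x $ a $ \<mu>\<close>, the component \<open>\<mu>\<close> of the one-form \<open>e\<^sup>a\<close> at \<open>x\<close>.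
  The value \<open>spin_connection e x a b\<close> is the one-form with both flat indices up; the index \<open>b\<close> is
  lowered with \<open>eta\<close> in the torsion equation.
\<close>

definition spin_connection :: "(real^4 \<Rightarrow> real^4^4) \<Rightarrow> real^4 \<Rightarrow> 4 \<Rightarrow> 4 \<Rightarrow> real^4" where
  "spin_connection e x = (THE \<omega>.
     (\<forall>a b. \<omega> a b = - \<omega> b a) \<and>
     (\<forall>a \<mu> \<nu>. ext_deriv (\<lambda>y. e y $ a) x \<mu> \<nu>
        + (\<Sum>b\<in>UNIV. wedge (\<Sum>c\<in>UNIV. eta c b *\<^sub>R \<omega> a c) (e x $ b) \<mu> \<nu>) = 0))"

definition flat_field_strength ::
    "(real^4 \<Rightarrow> real^4^4) \<Rightarrow> (real^4 \<Rightarrow> real^4) \<Rightarrow> real^4 \<Rightarrow> 4 \<Rightarrow> 4 \<Rightarrow> real" where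
  "flat_field_strength e A x = (THE F.
     (\<forall>a b. F a b = - F b a) \<and>
     (\<forall>\<mu> \<nu>. ext_deriv A x \<mu> \<nu> =
        1/2 * (\<Sum>a\<in>UNIV. \<Sum>b\<in>UNIV. F a b * wedge (e x $ a) (e x $ b) \<mu> \<nu>)))"

section \<open>Gamma matrices\<close>

definition real_gamma_matrices :: "(4 \<Rightarrow> complex^4^4) \<Rightarrow> bool" where
  "real_gamma_matrices \<gamma> \<longleftrightarrow>
     (\<forall>a i j. \<gamma> a $ i $ j \<in> \<real>) \<and>
     (\<forall>a b. \<gamma> a ** \<gamma> b + \<gamma> b ** \<gamma> a = mat (complex_of_real (2 * eta a b)))"

definition gamma2 :: "(4 \<Rightarrow> complex^4^4) \<Rightarrow> 4 \<Rightarrow> 4 \<Rightarrow> complex^4^4" where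
  "gamma2 \<gamma> a b = (1/2) *\<^sub>R (\<gamma> a ** \<gamma> b - \<gamma> b ** \<gamma> a)"

definition gamma2_up :: "(4 \<Rightarrow> complex^4^4) \<Rightarrow> 4 \<Rightarrow> 4 \<Rightarrow> complex^4^4" where
  "gamma2_up \<gamma> a b = (\<Sum>c\<in>UNIV. \<Sum>d\<in>UNIV. (eta a c * eta b d) *\<^sub>R gamma2 \<gamma> c d)"

definition gamma5 :: "(4 \<Rightarrow> complex^4^4) \<Rightarrow> complex^4^4" where
  "gamma5 \<gamma> = \<gamma> 0 ** \<gamma> 1 ** \<gamma> 2 ** \<gamma> 3"

definition gamma_coord ::
    "(4 \<Rightarrow> complex^4^4) \<Rightarrow> (real^4 \<Rightarrow> real^4^4) \<Rightarrow> real^4 \<Rightarrow> 4 \<Rightarrow> complex^4^4" where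
  "gamma_coord \<gamma> e x \<mu> = (\<Sum>a\<in>UNIV. (e x $ a $ \<mu>) *\<^sub>R \<gamma> a)"

text \<open>
  The product \<open>*\<close>, and hence \<open>^\<close> and \<open>exp\<close>, act componentwise on \<open>complex^4^4\<close>, so the matrix
  exponential is defined separately.
\<close>

primrec mat_pow :: "complex^4^4 \<Rightarrow> nat \<Rightarrow> complex^4^4" where
  "mat_pow A 0 = mat 1"
| "mat_pow A (Suc n) = A ** mat_pow A n"

definition mat_exp :: "complex^4^4 \<Rightarrow> complex^4^4" where
  "mat_exp A = (\<Sum>n. (1 / fact n) *\<^sub>R mat_pow A n)"

section \<open>Killing spinors\<close>

definition sugra_deriv ::
    "(4 \<Rightarrow> complex^4^4) \<Rightarrow> (real^4 \<Rightarrow> real^4^4) \<Rightarrow> (real^4 \<Rightarrow> real^4) \<Rightarrow>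
     4 \<Rightarrow> (real^4 \<Rightarrow> complex^4) \<Rightarrow> real^4 \<Rightarrow> complex^4" where
  "sugra_deriv \<gamma> e A \<mu> \<epsilon> x =
     partial_deriv \<mu> \<epsilon> x
     + ((1/4) *\<^sub>R (\<Sum>a\<in>UNIV. \<Sum>b\<in>UNIV. (spin_connection e x a b $ \<mu>) *\<^sub>R gamma2 \<gamma> a b)) *v \<epsilon> x
     + (mat (\<i> / 4)
        ** (\<Sum>a\<in>UNIV. \<Sum>b\<in>UNIV. flat_field_strength e A x a b *\<^sub>R gamma2_up \<gamma> a b)
        ** gamma_coord \<gamma> e x \<mu>) *v \<epsilon> x"

definition killing_spinor_on ::
    "(4 \<Rightarrow> complex^4^4) \<Rightarrow> (real^4 \<Rightarrow> real^4^4) \<Rightarrow> (real^4 \<Rightarrow> real^4) \<Rightarrow>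
     (real^4) set \<Rightarrow> (real^4 \<Rightarrow> complex^4) \<Rightarrow> bool" where
  "killing_spinor_on \<gamma> e A U \<epsilon> \<longleftrightarrow>
     (\<forall>x\<in>U. \<epsilon> differentiable (at x) \<and> (\<forall>\<mu>. sugra_deriv \<gamma> e A \<mu> \<epsilon> x = 0))"

text \<open>
  A spinor field on \<open>U\<close> is represented by the total function that vanishes outside \<open>U\<close>, so that
  fields on \<open>U\<close> are equal iff they agree on \<open>U\<close>.
\<close>

definition field_on :: "(real^4) set \<Rightarrow> (real^4 \<Rightarrow> complex^4) \<Rightarrow> real^4 \<Rightarrow> complex^4" where
  "field_on U \<epsilon> = (\<lambda>x. if x \<in> U then \<epsilon> x else 0)"

definition killing_spinors ::
    "(4 \<Rightarrow> complex^4^4) \<Rightarrow> (real^4 \<Rightarrow> real^4^4) \<Rightarrow> (real^4 \<Rightarrow> real^4) \<Rightarrow>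
     (real^4) set \<Rightarrow> (real^4 \<Rightarrow> complex^4) set" where
  "killing_spinors \<gamma> e A U = {\<epsilon>. killing_spinor_on \<gamma> e A U \<epsilon> \<and> (\<forall>x. x \<notin> U \<longrightarrow> \<epsilon> x = 0)}"

definition spinor_scale :: "complex \<Rightarrow> (real^4 \<Rightarrow> complex^4) \<Rightarrow> real^4 \<Rightarrow> complex^4" where
  "spinor_scale c \<epsilon> = (\<lambda>x. c *s \<epsilon> x)"

lemma vector_space_spinor_scale: "vector_space spinor_scale"
  by unfold_locales
     (simp_all add: spinor_scale_def fun_eq_iff vector_add_ldistrib vector_sadd_rdistrib
        vector_smult_assoc)

lemma subspace_killing_spinors: "module.subspace spinor_scale (killing_spinors \<gamma> e A U)"
proof -
  interpret vector_space spinor_scale by (rule vector_space_spinor_scale)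
  have bl: "bounded_linear (\<lambda>v::complex^4. c *s v)" for c
    by (rule linear_conv_bounded_linear[THEN iffD1])
       (auto intro!: linearI simp: vec_eq_iff algebra_simps)
  have lin: "sugra_deriv \<gamma> e A \<mu> (\<epsilon> + \<epsilon>') x = sugra_deriv \<gamma> e A \<mu> \<epsilon> x + sugra_deriv \<gamma> e A \<mu> \<epsilon>' x"
    if "\<epsilon> differentiable (at x)" "\<epsilon>' differentiable (at x)" for \<mu> \<epsilon> \<epsilon>' x
  proof -
    have "((\<lambda>y. \<epsilon> y + \<epsilon>' y) has_derivative
        (\<lambda>v. frechet_derivative \<epsilon> (at x) v + frechet_derivative \<epsilon>' (at x) v)) (at x)"
      using that by (intro has_derivative_add) (simp_all flip: frechet_derivative_works)
    from frechet_derivative_at[OF this]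
    have "partial_deriv \<mu> (\<epsilon> + \<epsilon>') x = partial_deriv \<mu> \<epsilon> x + partial_deriv \<mu> \<epsilon>' x"
      unfolding partial_deriv_def plus_fun_def by (rule fun_cong[OF sym])
    then show ?thesis
      by (simp add: sugra_deriv_def matrix_vector_right_distrib)
  qed
  have sc: "sugra_deriv \<gamma> e A \<mu> (spinor_scale c \<epsilon>) x = c *s sugra_deriv \<gamma> e A \<mu> \<epsilon> x"
    and sd: "spinor_scale c \<epsilon> differentiable (at x)"
    if "\<epsilon> differentiable (at x)" for \<mu> c \<epsilon> x
  proof -
    have d: "((\<lambda>y. c *s \<epsilon> y) has_derivative (\<lambda>v. c *s frechet_derivative \<epsilon> (at x) v)) (at x)"
      using that by (intro bounded_linear.has_derivative[OF bl]) (simp flip: frechet_derivative_works)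
    then show "spinor_scale c \<epsilon> differentiable (at x)"
      by (auto simp: spinor_scale_def differentiable_def)
    have "partial_deriv \<mu> (spinor_scale c \<epsilon>) x = c *s partial_deriv \<mu> \<epsilon> x"
      using frechet_derivative_at[OF d]
      unfolding partial_deriv_def spinor_scale_def by (rule fun_cong[OF sym])
    then show "sugra_deriv \<gamma> e A \<mu> (spinor_scale c \<epsilon>) x = c *s sugra_deriv \<gamma> e A \<mu> \<epsilon> x"
      by (simp add: sugra_deriv_def spinor_scale_def vector_scalar_commute vector_add_ldistrib)
  qed
  have z: "sugra_deriv \<gamma> e A \<mu> (\<lambda>_. 0) x = 0" for \<mu> x
    by (simp add: sugra_deriv_def partial_deriv_def)
  show ?thesis
    unfolding subspace_def killing_spinors_def killing_spinor_on_def
    using lin sc sd z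
    by (simp add: zero_fun_def) (simp add: plus_fun_def spinor_scale_def)
qed

section \<open>The charged Taub-NUT background\<close>

definition lam :: "real \<Rightarrow> real \<Rightarrow> real \<Rightarrow> real \<Rightarrow> real" where
  "lam M N Z r = r^2 - N^2 - 2 * M * r + Z^2"

definition Rad :: "real \<Rightarrow> real \<Rightarrow> real" where
  "Rad N r = sqrt (r^2 + N^2)"

definition region :: "real \<Rightarrow> (real^4) set" where
  "region M = {x. x $ 1 > max M 0 \<and> 0 < x $ 2 \<and> x $ 2 < pi}"

definition taub_nut_line_element ::
    "real \<Rightarrow> real \<Rightarrow> real \<Rightarrow> real^4 \<Rightarrow> real^4 \<Rightarrow> real" where
  "taub_nut_line_element M N Z x dx = (let r = x $ 1; \<theta> = x $ 2; \<Lambda> = lam M N Z r; R = Rad N r in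
     - (\<Lambda> / R^2) * (dx $ 0 + 2 * N * cos \<theta> * dx $ 3)^2 + (R^2 / \<Lambda>) * (dx $ 1)^2
     + R^2 * ((dx $ 2)^2 + (sin \<theta>)^2 * (dx $ 3)^2))"

definition vielbein :: "real \<Rightarrow> real \<Rightarrow> real \<Rightarrow> real^4 \<Rightarrow> real^4^4" where
  "vielbein M N Z x = (let r = x $ 1; \<theta> = x $ 2; \<Lambda> = lam M N Z r; R = Rad N r in
     \<chi> a. if a = 0 then (sqrt \<Lambda> / R) *\<^sub>R (axis 0 1 + (2 * N * cos \<theta>) *\<^sub>R axis 3 1)
          else if a = 1 then (R / sqrt \<Lambda>) *\<^sub>R axis 1 1
          else if a = 2 then R *\<^sub>R axis 2 1
          else (R * sin \<theta>) *\<^sub>R axis 3 1)"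

lemma lam_BPS: "M^2 + N^2 = Z^2 \<Longrightarrow> lam M N Z r = (r - M)^2"
  by (simp add: lam_def power2_eq_square algebra_simps)

lemma vielbein_line_element:
  assumes "lam M N Z (x $ 1) > 0"
  shows "(\<Sum>a\<in>UNIV. \<Sum>b\<in>UNIV. eta a b * (vielbein M N Z x $ a \<bullet> dx) * (vielbein M N Z x $ b \<bullet> dx))
         = taub_nut_line_element M N Z x dx"
proof -
  let ?r = "x $ 1" and ?\<theta> = "x $ 2"
  let ?e = "vielbein M N Z x"
  have "(4::4) = 0"
    by simp
  then have U: "UNIV = {0, 1, 2, 3 :: 4}"
    unfolding UNIV_4 by (simp only: insert_commute)
  have e: "?e $ 0 \<bullet> dx = sqrt (lam M N Z ?r) / Rad N ?r * (dx $ 0 + 2 * N * cos ?\<theta> * dx $ 3)"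
    "?e $ 1 \<bullet> dx = Rad N ?r / sqrt (lam M N Z ?r) * dx $ 1"
    "?e $ 2 \<bullet> dx = Rad N ?r * dx $ 2" "?e $ 3 \<bullet> dx = Rad N ?r * sin ?\<theta> * dx $ 3"
    by (simp_all add: vielbein_def Let_def inner_add_left inner_axis')
  have "(\<Sum>a\<in>UNIV. \<Sum>b\<in>UNIV. eta a b * (?e $ a \<bullet> dx) * (?e $ b \<bullet> dx))
      = - ((?e $ 0 \<bullet> dx)^2) + (?e $ 1 \<bullet> dx)^2 + (?e $ 2 \<bullet> dx)^2 + (?e $ 3 \<bullet> dx)^2"
    unfolding U by (simp add: eta_def power2_eq_square)
  also have "\<dots> = taub_nut_line_element M N Z x dx"
    unfolding e taub_nut_line_element_def Let_def power_mult_distrib power_divide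
      real_sqrt_pow2[OF less_imp_le[OF assms]]
    by (simp only: mult_minus_left distrib_left mult.assoc add.assoc)
  finally show ?thesis .
qed

definition gauge_potential :: "real \<Rightarrow> real \<Rightarrow> real \<Rightarrow> real^4 \<Rightarrow> real^4" where
  "gauge_potential N Q H x = (let r = x $ 1; \<theta> = x $ 2; R = Rad N r in
     ((Q * r + N * H) / R^2) *\<^sub>R axis 0 1
     + ((- H * (r^2 - N^2) + 2 * N * Q * r) / R^2 * cos \<theta>) *\<^sub>R axis 3 1)"

definition spinor_ansatz ::
    "(4 \<Rightarrow> complex^4^4) \<Rightarrow> real \<Rightarrow> real \<Rightarrow> (real \<Rightarrow> real) \<Rightarrow> real \<Rightarrow> real \<Rightarrow>
     complex^4 \<Rightarrow> real^4 \<Rightarrow> complex^4" where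
  "spinor_ansatz \<gamma> M N \<beta> \<alpha>\<^sub>m \<alpha>\<^sub>q \<epsilon>\<^sub>0 x = (let r = x $ 1; \<theta> = x $ 2; \<phi> = x $ 3 in
     (mat_exp ((\<theta> / 2) *\<^sub>R gamma2 \<gamma> 1 2)
      ** mat_exp ((\<phi> / 2) *\<^sub>R gamma2 \<gamma> 2 3)
      ** (sqrt ((r - M) / Rad N r) *\<^sub>R mat_exp ((\<beta> r / 2) *\<^sub>R gamma5 \<gamma>))
      ** ((1/2) *\<^sub>R (mat_exp (\<alpha>\<^sub>m *\<^sub>R gamma5 \<gamma>)
                     + mat \<i> ** mat_exp ((- \<alpha>\<^sub>q) *\<^sub>R gamma5 \<gamma>) ** \<gamma> 0))) *v \<epsilon>\<^sub>0)"

end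

(*
  Write J = gamma_5, f = (r - M)/R and U = e^{gamma_12 theta/2} e^{gamma_23 phi/2} sqrt f e^{beta J/2}.
  With C = (Z/R) e^{(beta - alpha_m) J} = p + q J and the involution Pi = i e^{(beta - alpha_q + alpha_m) J} gamma_0,
  the BPS condition turns every component of the supercovariant connection into
  - (d_mu U) U^{-1} plus a matrix times C (1 - Pi).  Since Pi U = U Pi_0 with the constant involution
  Pi_0 = i e^{(alpha_m - alpha_q) J} gamma_0, this gives nabla_mu (U eta) = U d_mu eta + (...) C U (1 - Pi_0) eta,
  so U eta is a Killing spinor for constant eta with Pi_0 eta = eta.  J anticommutes with Pi_0 and exchanges
  its eigenspaces, so there are two such eta; the projection in the ansatz has exactly this range.

  Conversely, for a Killing spinor U eta put w = f (1 - Pi_0) eta.  The r-equation gives d_r w = 0 and the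
  theta-equation d_theta w = - p(r) sigma w with sigma invertible and independent of r.  As p is not constant,
  w = 0, and then eta is constant.
*)
theory Submission
  imports Defs
begin

text \<open>The BPS condition acts through two products in the commutative algebra generated by J.
  The geometry enters as p + q J = (r + N J)(M - N J)/R^2, the field strength as u + v J = (r + N
  J)^2 (Q - H J)/R^3. Their moduli are sqrt(M^2 + N^2)/R and sqrt(Q^2 + H^2)/R. Because these agree,
  the field strength term i (u + v J) gamma_0 is C times an involution, and the connection
  degenerates on half of the spinors.

  The converse is shaped by regularity: a Killing spinor is only assumed differentiable once, so the
  commutator of two covariant derivatives is not directly available as an integrability condition.
  Invariance of w under translation in r replaces it: differentiating this invariance in theta
  compares the theta-equation at two radii and uses first derivatives only.

  The spin connection and the flat field strength are definite descriptions, so evaluating them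
  requires uniqueness as well as explicit solutions. This is done for a frame with arbitrary radial
  functions, of which only values and first derivatives at one point enter.\<close>

lemma UNIV_four: "(UNIV :: 4 set) = {0, 1, 2, 3}"
proof -
  \<comment> \<open>Numerals of the type \<open>4\<close> are read modulo 4, so the enumeration 1,
    2, 3, 4 is the same set as the frame indices 0, 1, 2, 3.\<close>
  have "(4::4) = 0"
    by simp
  then show ?thesis
    unfolding UNIV_4 by (simp only: insert_commute)
qed

lemma sum_four: "(\<Sum>a\<in>UNIV. f a) = f 0 + f 1 + f 2 + f (3 :: 4)" for f :: "4 \<Rightarrow> 'a::comm_monoid_add"
  unfolding UNIV_four by (simp add: add.assoc)

lemma all_four: "(\<forall>a. P a) \<longleftrightarrow> P 0 \<and> P 1 \<and> P 2 \<and> P (3 :: 4)"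
  using UNIV_four by (metis UNIV_I insertE singletonD)

text \<open>The ring operations of the type are componentwise, so the product rule and the
  distributive laws for genuine matrix products are obtained from bilinearity; \<open>mvmult\<close>
  does the same for the action on spinors.\<close>

interpretation mmult: bounded_bilinear "(**) :: complex^'n^'m \<Rightarrow> complex^'p^'n \<Rightarrow> complex^'p^'m"
  unfolding bilinear_conv_bounded_bilinear[symmetric] bilinear_def
  by (auto intro!: linearI simp: matrix_matrix_mult_def vec_eq_iff sum.distrib algebra_simps scaleR_sum_right)

interpretation mvmult: bounded_bilinear "(*v) :: complex^'n^'m \<Rightarrow> complex^'n \<Rightarrow> complex^'m"
  unfolding bilinear_conv_bounded_bilinear[symmetric] bilinear_def
  by (auto intro!: linearI simp: matrix_vector_mult_def vec_eq_iff sum.distrib algebra_simps scaleR_sum_right)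

text \<open>Products of matrices are nested to the right, whereas \<open>vec_ring\<close> collapses
  iterated actions on a vector into one matrix.\<close>

lemmas mat_ring = mmult.add_left mmult.add_right mmult.diff_left mmult.diff_right
  mmult.minus_left mmult.minus_right mmult.zero_left mmult.zero_right
  mmult.scaleR_left mmult.scaleR_right matrix_mul_assoc[symmetric] matrix_mul_lid matrix_mul_rid

lemmas vec_ring = mvmult.add_left mvmult.add_right mvmult.diff_left mvmult.diff_right
  mvmult.minus_left mvmult.minus_right mvmult.zero_left mvmult.zero_right
  mvmult.scaleR_left mvmult.scaleR_right matrix_vector_mul_assoc

lemma mat_mult_commute: "A ** mat c = mat c ** A" for A :: "complex^'n^'n"
  by (simp add: matrix_matrix_mult_def mat_def vec_eq_iff if_distrib if_distribR cong: if_cong)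

lemma mat_commute_left: "A ** (mat c ** B) = mat c ** (A ** B)" for A B :: "complex^'n^'n"
  by (metis mat_mult_commute matrix_mul_assoc)

lemma mat_ii_squared: "mat \<i> ** mat \<i> = (- mat 1 :: complex^'n^'n)"
proof -
  have "(if i = k then \<i> else 0) * (if k = j then \<i> else 0)
      = (if k = i then - (if i = j then 1 else 0) else 0)" for i j k :: 'n
    by simp
  then show ?thesis
    by (simp add: matrix_matrix_mult_def mat_def vec_eq_iff del: mult_if_delta)
qed

lemma mat_ii_squared_left: "mat \<i> ** (mat \<i> ** A) = - A" for A :: "complex^'n^'n"
  by (simp add: matrix_mul_assoc mat_ii_squared mmult.minus_left)

lemma mat_of_real: "mat (complex_of_real c) = c *\<^sub>R mat 1"
  by (simp add: mat_def vec_eq_iff of_real_def)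

lemma matrix_scale_commute: "A *v (c *s v) = c *s (A *v v)" for A :: "complex^'n^'m"
  by (simp add: vector_scalar_commute)

section \<open>Exponentials of complex structures\<close>

text \<open>Multiplication by \<open>J\<close> sends the pair (1, J) to (J, -1), which is the
  recursion of \<open>cos_coeff\<close> and \<open>sin_coeff\<close>; Euler's formula therefore
  holds term by term.\<close>

lemma mat_exp_sums:
  assumes "J ** J = - mat 1"
  shows "(\<lambda>n. (1 / fact n) *\<^sub>R mat_pow (s *\<^sub>R J) n) sums (cos s *\<^sub>R mat 1 + sin s *\<^sub>R J)"
proof -
  have "(1 / fact n) *\<^sub>R mat_pow (s *\<^sub>R J) n
      = (cos_coeff n *\<^sub>R s ^ n) *\<^sub>R mat 1 + (sin_coeff n *\<^sub>R s ^ n) *\<^sub>R J" for n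
  proof (induction n)
    case (Suc n)
    have "(1 / fact (Suc n)) *\<^sub>R mat_pow (s *\<^sub>R J) (Suc n)
        = (s / real (Suc n)) *\<^sub>R (J ** ((1 / fact n) *\<^sub>R mat_pow (s *\<^sub>R J) n))"
      by (simp add: mat_ring field_simps)
    also have "\<dots> = (s / real (Suc n)) *\<^sub>R
        (J ** ((cos_coeff n *\<^sub>R s ^ n) *\<^sub>R mat 1 + (sin_coeff n *\<^sub>R s ^ n) *\<^sub>R J))"
      by (simp only: Suc.IH)
    also have "\<dots> = (cos_coeff (Suc n) *\<^sub>R s ^ Suc n) *\<^sub>R mat 1 + (sin_coeff (Suc n) *\<^sub>R s ^ Suc n) *\<^sub>R J"
      unfolding cos_coeff_Suc sin_coeff_Suc
      by (simp add: mat_ring assms scaleR_add_right field_simps del: of_nat_Suc)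
    finally show ?case .
  qed simp
  then show ?thesis
    by (simp only:) (intro sums_add bounded_linear.sums[OF bounded_linear_scaleR_left]
      cos_converges sin_converges)
qed

lemma mat_exp_eq: "J ** J = - mat 1 \<Longrightarrow> mat_exp (s *\<^sub>R J) = cos s *\<^sub>R mat 1 + sin s *\<^sub>R J"
  unfolding mat_exp_def by (rule sums_unique[symmetric, OF mat_exp_sums])

lemma mat_exp_zero: "J ** J = - mat 1 \<Longrightarrow> mat_exp (0 *\<^sub>R J) = mat 1"
  by (subst mat_exp_eq) simp_all

lemma mat_exp_add:
  "J ** J = - mat 1 \<Longrightarrow> mat_exp (s *\<^sub>R J) ** mat_exp (t *\<^sub>R J) = mat_exp ((s + t) *\<^sub>R J)"
  by (simp only: mat_exp_eq) (simp add: mat_ring cos_add sin_add algebra_simps)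

lemma mat_exp_commute:
  "J ** J = - mat 1 \<Longrightarrow> A ** J = J ** A \<Longrightarrow> A ** mat_exp (s *\<^sub>R J) = mat_exp (s *\<^sub>R J) ** A"
  by (simp add: mat_exp_eq mat_ring)

lemma mat_exp_anticommute:
  "J ** J = - mat 1 \<Longrightarrow> A ** J = - (J ** A) \<Longrightarrow> A ** mat_exp (s *\<^sub>R J) = mat_exp ((- s) *\<^sub>R J) ** A"
  by (simp only: mat_exp_eq) (simp add: mat_ring)

lemma has_derivative_mat_exp:
  assumes "J ** J = - mat 1" and g: "(g has_derivative g') (at x within S)"
  shows "((\<lambda>y. mat_exp (g y *\<^sub>R J)) has_derivative (\<lambda>h. g' h *\<^sub>R (J ** mat_exp (g x *\<^sub>R J)))) (at x within S)"
  unfolding mat_exp_eq[OF assms(1)]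
  by (auto intro!: derivative_eq_intros g simp: mat_ring assms(1) fun_eq_iff algebra_simps)

section \<open>The Clifford algebra\<close>

locale clifford =
  fixes \<gamma> :: "4 \<Rightarrow> complex^4^4"
  assumes anticommutator: "\<gamma> a ** \<gamma> b + \<gamma> b ** \<gamma> a = mat (complex_of_real (2 * eta a b))"
begin

lemma gamma_commute: "a \<noteq> b \<Longrightarrow> \<gamma> a ** \<gamma> b = - (\<gamma> b ** \<gamma> a)"
  using anticommutator[of a b] by (simp add: eta_def eq_neg_iff_add_eq_0 mat_def vec_eq_iff)

lemma gamma_squared: "\<gamma> a ** \<gamma> a = (if a = 0 then - mat 1 else mat 1)"
proof -
  have "\<gamma> a ** \<gamma> a = (1/2) *\<^sub>R (\<gamma> a ** \<gamma> a + \<gamma> a ** \<gamma> a)"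
    by (simp flip: scaleR_2)
  then show ?thesis
    by (simp only: anticommutator mat_of_real) (simp add: eta_def)
qed

lemma gamma_commute_left: "a \<noteq> b \<Longrightarrow> \<gamma> a ** (\<gamma> b ** X) = - (\<gamma> b ** (\<gamma> a ** X))"
  by (simp add: matrix_mul_assoc gamma_commute[of a b] mmult.minus_left)

lemma gamma_squared_left: "\<gamma> a ** (\<gamma> a ** X) = (if a = 0 then - X else X)"
  by (simp add: matrix_mul_assoc gamma_squared mmult.minus_left)

text \<open>Oriented so that products of gamma matrices are sorted by increasing index.\<close>

lemmas clifford_simps = mat_ring gamma_squared gamma_squared_left
  gamma_commute[of 1 0] gamma_commute[of 2 0] gamma_commute[of 3 0]
  gamma_commute[of 2 1] gamma_commute[of 3 1] gamma_commute[of 3 2]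
  gamma_commute_left[of 1 0] gamma_commute_left[of 2 0] gamma_commute_left[of 3 0]
  gamma_commute_left[of 2 1] gamma_commute_left[of 3 1] gamma_commute_left[of 3 2]
  mat_mult_commute[of "\<gamma> a" for a] mat_commute_left[of "\<gamma> a" for a]

abbreviation "J \<equiv> gamma5 \<gamma>"

lemma gamma5_eq: "J = \<gamma> 0 ** (\<gamma> 1 ** (\<gamma> 2 ** \<gamma> 3))"
  by (simp add: gamma5_def matrix_mul_assoc)

lemma gamma5_squared: "J ** J = - mat 1"
  by (simp add: gamma5_eq clifford_simps)

lemma gamma5_anticommute: "\<gamma> a ** J = - (J ** \<gamma> a)"
proof -
  have "\<forall>a. \<gamma> a ** J = - (J ** \<gamma> a)"
    unfolding all_four by (simp add: gamma5_eq clifford_simps)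
  then show ?thesis ..
qed

lemma gamma5_anticommute_left: "\<gamma> a ** (J ** X) = - (J ** (\<gamma> a ** X))"
  by (simp add: matrix_mul_assoc gamma5_anticommute mmult.minus_left)

lemma gamma2_eq: "a \<noteq> b \<Longrightarrow> gamma2 \<gamma> a b = \<gamma> a ** \<gamma> b"
  by (simp add: gamma2_def gamma_commute[of b a] flip: scaleR_2)

lemma gamma2_antisym: "gamma2 \<gamma> a b = - gamma2 \<gamma> b a"
  by (simp add: gamma2_def scaleR_diff_right)

lemma gamma2_up_eq: "gamma2_up \<gamma> a b = (eta a a * eta b b) *\<^sub>R gamma2 \<gamma> a b"
proof -
  have eta: "eta a c = (if c = a then eta a a else 0)" for a c
    by (simp add: eta_def)
  show ?thesis
    unfolding gamma2_up_def
    by (subst (1 2) eta) (simp add: if_distribR if_distrib[of "\<lambda>z. z *\<^sub>R _"] if_distrib[of "(*) _"]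
      if_distrib[of "\<lambda>z. z * _"] cong: if_cong)
qed

lemma gamma2_up_antisym: "gamma2_up \<gamma> a b = - gamma2_up \<gamma> b a"
  unfolding gamma2_up_eq by (subst gamma2_antisym) (simp add: mult.commute)

lemma gamma2_gamma5: "gamma2 \<gamma> a b ** J = J ** gamma2 \<gamma> a b"
  by (simp add: gamma2_def mat_ring gamma5_anticommute gamma5_anticommute_left)

lemma gamma2_squared: "a \<noteq> b \<Longrightarrow> a \<noteq> 0 \<Longrightarrow> b \<noteq> 0 \<Longrightarrow> gamma2 \<gamma> a b ** gamma2 \<gamma> a b = - mat 1"
  by (simp add: gamma2_eq mat_ring gamma_commute_left[of b a] gamma_squared_left gamma_squared)

end

section \<open>Partial derivatives, torsion and field strength\<close>

lemma partial_deriv_eqI: "(f has_derivative f') (at x) \<Longrightarrow> partial_deriv \<mu> f x = f' (axis \<mu> 1)"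
  unfolding partial_deriv_def by (metis frechet_derivative_at)

lemma partial_deriv_zero [simp]: "partial_deriv \<mu> (\<lambda>_. 0) x = 0"
  by (simp add: partial_deriv_eqI[OF has_derivative_const])

lemma has_derivative_vec_nth: "((\<lambda>y. y $ i) has_derivative (\<lambda>h. h $ i)) (at x within S)"
  by (rule bounded_linear.has_derivative[OF bounded_linear_vec_nth has_derivative_ident])

lemma has_derivative_coordinate:
  assumes "(g has_real_derivative g') (at (x $ i))"
  shows "((\<lambda>y. g (y $ i)) has_derivative (\<lambda>h. g' * h $ i)) (at x)"
  using has_derivative_compose[OF has_derivative_vec_nth assms[unfolded has_field_derivative_def]]
  by simp

lemma partial_deriv_prod:
  assumes "(g has_real_derivative g') (at (x $ 1))" "(h has_real_derivative h') (at (x $ 2))"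
  shows "partial_deriv \<mu> (\<lambda>y. g (y $ 1) * h (y $ 2)) x
    = (if \<mu> = 1 then g' * h (x $ 2) else if \<mu> = 2 then g (x $ 1) * h' else 0)"
  by (subst partial_deriv_eqI[OF has_derivative_mult[OF assms[THEN has_derivative_coordinate]]])
    (simp add: axis_def)

lemma eta_sum: "(\<Sum>c\<in>UNIV. eta c b *\<^sub>R v c) = eta b b *\<^sub>R v b"
  for v :: "4 \<Rightarrow> real^4"
proof -
  have "(\<Sum>c\<in>UNIV. eta c b *\<^sub>R v c) = (\<Sum>c\<in>UNIV. if c = b then eta b b *\<^sub>R v b else 0)"
    by (intro sum.cong) (simp_all add: eta_def)
  then show ?thesis
    by simp
qed

text \<open>Applied to the difference of two candidates in the definite description of the spin
  connection. With all indices flat and lowered, vanishing torsion is symmetry in the last two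
  indices and metricity is antisymmetry in the first two; together they force zero.\<close>

lemma torsion_free_unique:
  fixes \<kappa> :: "4 \<Rightarrow> 4 \<Rightarrow> real^4"
  assumes "invertible E"
    and antisym: "\<And>a b. \<kappa> a b = - \<kappa> b a"
    and sym: "\<And>a \<mu> \<nu>. (\<Sum>b\<in>UNIV. eta b b * \<kappa> a b $ \<mu> * E $ b $ \<nu>)
      = (\<Sum>b\<in>UNIV. eta b b * \<kappa> a b $ \<nu> * E $ b $ \<mu>)"
  shows "\<kappa> a b = 0"
proof -
  obtain G where EG: "E ** G = mat 1" and GE: "G ** E = mat 1"
    using \<open>invertible E\<close> unfolding invertible_def by blast
  have EG: "(\<Sum>\<nu>\<in>UNIV. E $ a $ \<nu> * G $ \<nu> $ b) = (if a = b then 1 else 0)" for a b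
    using arg_cong[OF EG, of "\<lambda>X. X $ a $ b"] by (simp add: matrix_matrix_mult_def mat_def)
  have GE: "(\<Sum>c\<in>UNIV. G $ \<mu> $ c * E $ c $ \<nu>) = (if \<mu> = \<nu> then 1 else 0)" for \<mu> \<nu>
    using arg_cong[OF GE, of "\<lambda>X. X $ \<mu> $ \<nu>"] by (simp add: matrix_matrix_mult_def mat_def)
  \<comment> \<open>The form index is converted to a flat index with the dual frame
    \<open>G\<close>.\<close>
  define K where "K a b c = (\<Sum>\<mu>\<in>UNIV. \<kappa> a b $ \<mu> * G $ \<mu> $ c)" for a b c
  have contract: "(\<Sum>\<nu>\<in>UNIV. (\<Sum>b\<in>UNIV. eta b b * \<kappa> a b $ \<mu> * E $ b $ \<nu>) * G $ \<nu> $ d)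
      = eta d d * \<kappa> a d $ \<mu>" for a d \<mu>
  proof -
    have "(\<Sum>\<nu>\<in>UNIV. (\<Sum>b\<in>UNIV. eta b b * \<kappa> a b $ \<mu> * E $ b $ \<nu>) * G $ \<nu> $ d)
      = (\<Sum>b\<in>UNIV. eta b b * \<kappa> a b $ \<mu> * (\<Sum>\<nu>\<in>UNIV. E $ b $ \<nu> * G $ \<nu> $ d))"
      by (simp add: sum_distrib_left sum_distrib_right mult.assoc) (rule sum.swap)
    then show ?thesis
      by (simp add: EG if_distrib[of "(*) _"] cong: if_cong)
  qed
  have K_sym: "eta d d * K a d c = eta c c * K a c d" for a c d
  proof -
    have "eta d d * K a d c
      = (\<Sum>\<mu>\<in>UNIV. (\<Sum>\<nu>\<in>UNIV. (\<Sum>b\<in>UNIV. eta b b * \<kappa> a b $ \<mu> * E $ b $ \<nu>) * G $ \<nu> $ d) * G $ \<mu> $ c)"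
      unfolding contract K_def by (simp add: sum_distrib_left mult.assoc)
    also have "\<dots> = (\<Sum>\<mu>\<in>UNIV. \<Sum>\<nu>\<in>UNIV. (\<Sum>b\<in>UNIV. eta b b * \<kappa> a b $ \<nu> * E $ b $ \<mu>) * G $ \<mu> $ c * G $ \<nu> $ d)"
      by (subst sym) (simp add: sum_distrib_left sum_distrib_right mult_ac)
    also have "\<dots> = (\<Sum>\<nu>\<in>UNIV. (\<Sum>\<mu>\<in>UNIV. (\<Sum>b\<in>UNIV. eta b b * \<kappa> a b $ \<nu> * E $ b $ \<mu>) * G $ \<mu> $ c) * G $ \<nu> $ d)"
      by (subst sum.swap) (simp add: sum_distrib_right)
    also have "\<dots> = eta c c * K a c d"
      unfolding contract K_def by (simp add: sum_distrib_left mult.assoc)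
    finally show ?thesis .
  qed
  have K_antisym: "K a b c = - K b a c" for a b c
    unfolding K_def by (subst antisym) (simp add: sum_negf)
  define L where "L a b c = eta a a * eta b b * K a b c" for a b c
  have L_sym: "L a b c = L a c b" for a b c
    using K_sym[of b a c] by (simp add: L_def mult.assoc)
  have L_antisym: "L a b c = - L b a c" for a b c
    using K_antisym[of a b c] by (simp add: L_def)
  \<comment> \<open>Six alternating transpositions return to the original index order with three
    sign changes, so \<open>L a b c = - L a b c\<close>.\<close>
  have "L a b c = 0" for a b c
    using L_sym[of a b c] L_antisym[of a c b] L_sym[of c a b] L_antisym[of c b a] L_sym[of b c a]
      L_antisym[of b a c]
    by linarith
  then have K0: "K a b c = 0" for a b c
    by (metis L_def eta_def mult_eq_0_iff neg_equal_0_iff_equal zero_neq_one)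
  have "\<kappa> a b $ \<nu> = 0" for \<nu>
  proof -
    have "\<kappa> a b $ \<nu> = (\<Sum>\<mu>\<in>UNIV. \<kappa> a b $ \<mu> * (\<Sum>c\<in>UNIV. G $ \<mu> $ c * E $ c $ \<nu>))"
      by (simp add: GE if_distrib[of "(*) _"] cong: if_cong)
    also have "\<dots> = (\<Sum>c\<in>UNIV. K a b c * E $ c $ \<nu>)"
      by (simp add: K_def sum_distrib_left sum_distrib_right mult.assoc) (rule sum.swap)
    finally show ?thesis
      by (simp add: K0)
  qed
  then show ?thesis
    by (simp add: vec_eq_iff)
qed

lemma spin_connection_eqI:
  assumes "invertible (e x)"
    and "\<And>a b. \<omega> a b = - \<omega> b a"
    and "\<And>a \<mu> \<nu>. ext_deriv (\<lambda>y. e y $ a) x \<mu> \<nu>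
      + (\<Sum>b\<in>UNIV. wedge (eta b b *\<^sub>R \<omega> a b) (e x $ b) \<mu> \<nu>) = 0"
  shows "spin_connection e x = \<omega>"
  unfolding spin_connection_def eta_sum
proof (rule the_equality)
  fix \<omega>' :: "4 \<Rightarrow> 4 \<Rightarrow> real^4"
  assume \<omega>': "(\<forall>a b. \<omega>' a b = - \<omega>' b a) \<and>
     (\<forall>a \<mu> \<nu>. ext_deriv (\<lambda>y. e y $ a) x \<mu> \<nu>
        + (\<Sum>b\<in>UNIV. wedge (eta b b *\<^sub>R \<omega>' a b) (e x $ b) \<mu> \<nu>) = 0)"
  have "\<omega>' a b - \<omega> a b = 0" for a b
  proof (rule torsion_free_unique[OF assms(1)])
    show "\<omega>' a b - \<omega> a b = - (\<omega>' b a - \<omega> b a)" for a b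
      using \<omega>'[THEN conjunct1, rule_format, of a b] assms(2)[of a b] by simp
    fix a \<mu> \<nu>
    have "(\<Sum>b\<in>UNIV. wedge (eta b b *\<^sub>R \<omega>' a b) (e x $ b) \<mu> \<nu>)
      = (\<Sum>b\<in>UNIV. wedge (eta b b *\<^sub>R \<omega> a b) (e x $ b) \<mu> \<nu>)"
      using \<omega>'[THEN conjunct2, rule_format, of a \<mu> \<nu>] assms(3)[of a \<mu> \<nu>] by linarith
    then show "(\<Sum>b\<in>UNIV. eta b b * (\<omega>' a b - \<omega> a b) $ \<mu> * e x $ b $ \<nu>)
      = (\<Sum>b\<in>UNIV. eta b b * (\<omega>' a b - \<omega> a b) $ \<nu> * e x $ b $ \<mu>)"
      by (simp add: wedge_def algebra_simps sum_subtractf)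
  qed
  then show "\<omega>' = \<omega>"
    by (simp add: fun_eq_iff)
qed (intro conjI allI assms(2,3))

text \<open>In matrix form the hypothesis is the congruence
  \<open>transpose E ** X ** E = 0\<close>, which an invertible \<open>E\<close> can undo from both
  sides.\<close>

lemma two_form_components_unique:
  fixes F :: "4 \<Rightarrow> 4 \<Rightarrow> real"
  assumes "invertible E"
    and antisym: "\<And>a b. F a b = - F b a"
    and zero: "\<And>\<mu> \<nu>. (\<Sum>a\<in>UNIV. \<Sum>b\<in>UNIV. F a b * wedge (E $ a) (E $ b) \<mu> \<nu>) = 0"
  shows "F a b = 0"
proof -
  define X :: "real^4^4" where "X = (\<chi> a b. F a b)"
  \<comment> \<open>By antisymmetry of \<open>F\<close> the two terms of each wedge contribute
    equally, so the given sum is twice this contraction.\<close>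
  have sum0: "(\<Sum>a\<in>UNIV. \<Sum>b\<in>UNIV. F a b * E $ a $ \<mu> * E $ b $ \<nu>) = 0" for \<mu> \<nu>
  proof -
    have "(\<Sum>a\<in>UNIV. \<Sum>b\<in>UNIV. F a b * E $ a $ \<nu> * E $ b $ \<mu>)
        = (\<Sum>b\<in>UNIV. \<Sum>a\<in>UNIV. F a b * E $ a $ \<nu> * E $ b $ \<mu>)"
      by (rule sum.swap)
    also have "\<dots> = - (\<Sum>a\<in>UNIV. \<Sum>b\<in>UNIV. F a b * E $ a $ \<mu> * E $ b $ \<nu>)"
      by (subst antisym) (simp add: sum_negf mult_ac)
    finally show ?thesis
      using zero[of \<mu> \<nu>] by (simp add: wedge_def algebra_simps sum_subtractf)
  qed
  have "(transpose E ** X ** E) $ \<mu> $ \<nu>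
      = (\<Sum>b\<in>UNIV. \<Sum>a\<in>UNIV. F a b * E $ a $ \<mu> * E $ b $ \<nu>)" for \<mu> \<nu>
    by (simp add: matrix_matrix_mult_def transpose_def X_def sum_distrib_left sum_distrib_right mult_ac)
  then have "(transpose E ** X ** E) $ \<mu> $ \<nu> = 0" for \<mu> \<nu>
    using sum0[of \<mu> \<nu>] by (subst (asm) sum.swap) simp
  then have "transpose E ** X ** E = 0"
    by (simp add: vec_eq_iff)
  moreover obtain G where EG: "E ** G = mat 1"
    using \<open>invertible E\<close> unfolding invertible_def by blast
  then have "transpose G ** transpose E = mat 1"
    by (metis matrix_transpose_mul transpose_mat)
  then have "X = transpose G ** transpose E ** X ** (E ** G)"
    by (simp add: EG)
  then have "X = transpose G ** (transpose E ** X ** E) ** G"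
    by (simp only: matrix_mul_assoc)
  ultimately have "X = 0"
    by (simp add: matrix_matrix_mult_def vec_eq_iff)
  then have "X $ a $ b = 0"
    by simp
  then show ?thesis
    by (simp add: X_def)
qed

lemma flat_field_strength_eqI:
  assumes "invertible (e x)"
    and "\<And>a b. F a b = - F b a"
    and "\<And>\<mu> \<nu>. ext_deriv A x \<mu> \<nu>
      = 1/2 * (\<Sum>a\<in>UNIV. \<Sum>b\<in>UNIV. F a b * wedge (e x $ a) (e x $ b) \<mu> \<nu>)"
  shows "flat_field_strength e A x = F"
  unfolding flat_field_strength_def
proof (rule the_equality)
  fix F' :: "4 \<Rightarrow> 4 \<Rightarrow> real"
  assume F': "(\<forall>a b. F' a b = - F' b a) \<and> (\<forall>\<mu> \<nu>. ext_deriv A x \<mu> \<nu>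
    = 1/2 * (\<Sum>a\<in>UNIV. \<Sum>b\<in>UNIV. F' a b * wedge (e x $ a) (e x $ b) \<mu> \<nu>))"
  have "F' a b - F a b = 0" for a b
  proof (rule two_form_components_unique[OF assms(1)])
    show "F' a b - F a b = - (F' b a - F b a)" for a b
      using F'[THEN conjunct1, rule_format, of a b] assms(2)[of a b] by simp
    show "(\<Sum>a\<in>UNIV. \<Sum>b\<in>UNIV. (F' a b - F a b) * wedge (e x $ a) (e x $ b) \<mu> \<nu>) = 0" for \<mu> \<nu>
      using F'[THEN conjunct2, rule_format, of \<mu> \<nu>] assms(3)[of \<mu> \<nu>] by (simp add: left_diff_distrib sum_subtractf)
  qed
  then show "F' = F"
    by (simp add: fun_eq_iff)
qed (intro conjI allI assms(2,3))

section \<open>Coframes with a NUT fibration\<close>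

text \<open>\<open>f\<close> stands for sqrt(\<lambda>)/R; the same function governs the time and
  the radial leg, once directly and once inverted.\<close>

definition nut_frame :: "real \<Rightarrow> (real \<Rightarrow> real) \<Rightarrow> (real \<Rightarrow> real) \<Rightarrow> real^4 \<Rightarrow> real^4^4" where
  "nut_frame N f R y = (\<chi> a.
     if a = 0 then f (y $ 1) *\<^sub>R (axis 0 1 + (2 * N * cos (y $ 2)) *\<^sub>R axis 3 1)
     else if a = 1 then (1 / f (y $ 1)) *\<^sub>R axis 1 1
     else if a = 2 then R (y $ 1) *\<^sub>R axis 2 1
     else (R (y $ 1) * sin (y $ 2)) *\<^sub>R axis 3 1)"

definition nut_potential :: "(real \<Rightarrow> real) \<Rightarrow> (real \<Rightarrow> real) \<Rightarrow> real^4 \<Rightarrow> real^4" where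
  "nut_potential A\<^sub>t A\<^sub>\<phi> y = A\<^sub>t (y $ 1) *\<^sub>R axis 0 1 + (A\<^sub>\<phi> (y $ 1) * cos (y $ 2)) *\<^sub>R axis 3 1"

lemma nut_frame_zero:
  "nut_frame N f R y $ 0 $ 1 = 0" "nut_frame N f R y $ 0 $ 2 = 0"
  "nut_frame N f R y $ 1 $ 0 = 0" "nut_frame N f R y $ 1 $ 2 = 0" "nut_frame N f R y $ 1 $ 3 = 0"
  "nut_frame N f R y $ 2 $ 0 = 0" "nut_frame N f R y $ 2 $ 1 = 0" "nut_frame N f R y $ 2 $ 3 = 0"
  "nut_frame N f R y $ 3 $ 0 = 0" "nut_frame N f R y $ 3 $ 1 = 0" "nut_frame N f R y $ 3 $ 2 = 0"
  by (simp_all add: nut_frame_def axis_def)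

lemma nut_frame_nonzero:
  "nut_frame N f R y $ 0 $ 0 = f (y $ 1)" "nut_frame N f R y $ 0 $ 3 = f (y $ 1) * (2 * N * cos (y $ 2))"
  "nut_frame N f R y $ 1 $ 1 = 1 / f (y $ 1)" "nut_frame N f R y $ 2 $ 2 = R (y $ 1)"
  "nut_frame N f R y $ 3 $ 3 = R (y $ 1) * sin (y $ 2)"
  by (simp_all add: nut_frame_def axis_def)

lemma nut_potential_nth:
  "nut_potential A\<^sub>t A\<^sub>\<phi> y $ 0 = A\<^sub>t (y $ 1)" "nut_potential A\<^sub>t A\<^sub>\<phi> y $ 1 = 0"
  "nut_potential A\<^sub>t A\<^sub>\<phi> y $ 2 = 0" "nut_potential A\<^sub>t A\<^sub>\<phi> y $ 3 = A\<^sub>\<phi> (y $ 1) * cos (y $ 2)"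
  by (simp_all add: nut_potential_def axis_def)

lemma invertible_nut_frame:
  assumes "f (y $ 1) \<noteq> 0" "R (y $ 1) \<noteq> 0" "sin (y $ 2) \<noteq> 0"
  shows "invertible (nut_frame N f R y)"
proof -
  \<comment> \<open>Column \<open>a\<close> is the dual vector e_a. The one along \<phi> is
    (d_\<phi> - 2 N cos \<theta> d_t)/(R sin \<theta>), whose time component removes the fibre part
    of e^0.\<close>
  define G :: "real^4^4" where "G = (\<chi> \<mu> a.
    if \<mu> = 0 then (if a = 0 then 1 / f (y $ 1) else if a = 3 then - 2 * N * cos (y $ 2) / (R (y $ 1) * sin (y $ 2)) else 0)
    else if \<mu> \<noteq> a then 0 else if a = 1 then f (y $ 1) else if a = 2 then 1 / R (y $ 1)
    else 1 / (R (y $ 1) * sin (y $ 2)))"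
  have "\<forall>a b. (nut_frame N f R y ** G) $ a $ b = mat 1 $ a $ b"
    unfolding all_four
    by (simp add: matrix_matrix_mult_def sum_four nut_frame_zero nut_frame_nonzero G_def mat_def assms)
  then have "nut_frame N f R y ** G = mat 1"
    by (simp add: vec_eq_iff)
  then show ?thesis
    by (auto simp: invertible_right_inverse)
qed

text \<open>The condition on the derivative of \<open>A\<^sub>\<phi>\<close> makes the coefficient
  of dr wedge d\<phi> come only from dr wedge e^0. Hence F has no component along e^1 wedge e^3, and
  only its electric and magnetic radial parts remain.\<close>

locale nut_background =
  fixes N :: real and f R A\<^sub>t A\<^sub>\<phi> :: "real \<Rightarrow> real" and x :: "real^4" and f' R' A\<^sub>t' :: real
  assumes DERIV_f: "(f has_real_derivative f') (at (x $ 1))"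
    and DERIV_R: "(R has_real_derivative R') (at (x $ 1))"
    and DERIV_A\<^sub>t: "(A\<^sub>t has_real_derivative A\<^sub>t') (at (x $ 1))"
    and DERIV_A\<^sub>\<phi>: "(A\<^sub>\<phi> has_real_derivative 2 * N * A\<^sub>t') (at (x $ 1))"
    and f_nonzero: "f (x $ 1) \<noteq> 0" and R_nonzero: "R (x $ 1) \<noteq> 0" and sin_nonzero: "sin (x $ 2) \<noteq> 0"
begin

text \<open>Entries with a < b only; the connection is the antisymmetrization. The terms with
  \<open>k\<close> stem from the twist of the fibration, the component -2 k of d(e^0) along e^2
  wedge e^3.\<close>

definition omega_upper :: "4 \<Rightarrow> 4 \<Rightarrow> real^4" where
  "omega_upper a b = (let e = nut_frame N f R x; k = N * f (x $ 1) / (R (x $ 1))\<^sup>2 in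
     if a = 0 \<and> b = 1 then f' *\<^sub>R e $ 0
     else if a = 0 \<and> b = 2 then (- k) *\<^sub>R e $ 3
     else if a = 0 \<and> b = 3 then k *\<^sub>R e $ 2
     else if a = 1 \<and> b = 2 then (- (f (x $ 1) * R' / R (x $ 1))) *\<^sub>R e $ 2
     else if a = 1 \<and> b = 3 then (- (f (x $ 1) * R' / R (x $ 1))) *\<^sub>R e $ 3
     else if a = 2 \<and> b = 3 then (- (cos (x $ 2) / (R (x $ 1) * sin (x $ 2)))) *\<^sub>R e $ 3 + (- k) *\<^sub>R e $ 0
     else 0)"

definition F_upper :: "4 \<Rightarrow> 4 \<Rightarrow> real" where
  "F_upper a b = (if a = 0 \<and> b = 1 then - A\<^sub>t'
     else if a = 2 \<and> b = 3 then - A\<^sub>\<phi> (x $ 1) / (R (x $ 1))\<^sup>2 else 0)"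

lemma partial_deriv_frame:
  "partial_deriv \<mu> (\<lambda>y. nut_frame N f R y $ 0 $ 0) x = (if \<mu> = 1 then f' else 0)"
  "partial_deriv \<mu> (\<lambda>y. nut_frame N f R y $ 0 $ 3) x = (if \<mu> = 1 then f' * (2 * N * cos (x $ 2))
     else if \<mu> = 2 then f (x $ 1) * (- 2 * N * sin (x $ 2)) else 0)"
  "partial_deriv \<mu> (\<lambda>y. nut_frame N f R y $ 2 $ 2) x = (if \<mu> = 1 then R' else 0)"
  "partial_deriv \<mu> (\<lambda>y. nut_frame N f R y $ 3 $ 3) x = (if \<mu> = 1 then R' * sin (x $ 2)
     else if \<mu> = 2 then R (x $ 1) * cos (x $ 2) else 0)"
  using partial_deriv_prod[OF DERIV_f DERIV_const[of 1], of \<mu>]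
    partial_deriv_prod[OF DERIV_f DERIV_cmult[OF DERIV_cos, of "2 * N"], of \<mu>]
    partial_deriv_prod[OF DERIV_R DERIV_const[of 1], of \<mu>]
    partial_deriv_prod[OF DERIV_R DERIV_sin, of \<mu>]
  by (simp_all add: nut_frame_nonzero)

text \<open>The case \<open>\<mu> = 1\<close> never enters d(e^1), because dr wedge dr
  vanishes.\<close>

lemma partial_deriv_frame_11:
  "\<mu> \<noteq> 1 \<Longrightarrow> partial_deriv \<mu> (\<lambda>y. nut_frame N f R y $ 1 $ 1) x = 0"
  using partial_deriv_prod[OF DERIV_inverse'[OF DERIV_f f_nonzero] DERIV_const[of 1], of \<mu>]
  by (auto simp: nut_frame_nonzero inverse_eq_divide)

lemma partial_deriv_potential:
  "partial_deriv \<mu> (\<lambda>y. nut_potential A\<^sub>t A\<^sub>\<phi> y $ 0) x = (if \<mu> = 1 then A\<^sub>t' else 0)"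
  "partial_deriv \<mu> (\<lambda>y. nut_potential A\<^sub>t A\<^sub>\<phi> y $ 3) x = (if \<mu> = 1 then 2 * N * A\<^sub>t' * cos (x $ 2)
     else if \<mu> = 2 then A\<^sub>\<phi> (x $ 1) * (- sin (x $ 2)) else 0)"
  using partial_deriv_prod[OF DERIV_A\<^sub>t DERIV_const[of 1], of \<mu>]
    partial_deriv_prod[OF DERIV_A\<^sub>\<phi> DERIV_cos, of \<mu>]
  by (simp_all add: nut_potential_nth)

lemma spin_connection_nut_frame:
  "spin_connection (nut_frame N f R) x = (\<lambda>a b. omega_upper a b - omega_upper b a)"
proof (rule spin_connection_eqI)
  show "invertible (nut_frame N f R x)"
    using f_nonzero R_nonzero sin_nonzero by (rule invertible_nut_frame)
  have "\<forall>a \<mu> \<nu>. ext_deriv (\<lambda>y. nut_frame N f R y $ a) x \<mu> \<nu>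
    + (\<Sum>b\<in>UNIV. wedge (eta b b *\<^sub>R (omega_upper a b - omega_upper b a)) (nut_frame N f R x $ b) \<mu> \<nu>) = 0"
    unfolding all_four
    by (simp add: ext_deriv_def partial_deriv_frame partial_deriv_frame_11 nut_frame_zero sum_four
        wedge_def eta_def omega_upper_def Let_def)
      (simp add: nut_frame_nonzero f_nonzero R_nonzero sin_nonzero field_simps power2_eq_square)
  then show "ext_deriv (\<lambda>y. nut_frame N f R y $ a) x \<mu> \<nu>
    + (\<Sum>b\<in>UNIV. wedge (eta b b *\<^sub>R (omega_upper a b - omega_upper b a)) (nut_frame N f R x $ b) \<mu> \<nu>) = 0"
    for a \<mu> \<nu> by blast
qed simp

lemma field_strength_nut_potential:
  "flat_field_strength (nut_frame N f R) (nut_potential A\<^sub>t A\<^sub>\<phi>) x = (\<lambda>a b. F_upper a b - F_upper b a)"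
proof (rule flat_field_strength_eqI)
  show "invertible (nut_frame N f R x)"
    using f_nonzero R_nonzero sin_nonzero by (rule invertible_nut_frame)
  have "\<forall>\<mu> \<nu>. ext_deriv (nut_potential A\<^sub>t A\<^sub>\<phi>) x \<mu> \<nu> = 1/2 * (\<Sum>a\<in>UNIV. \<Sum>b\<in>UNIV.
      (F_upper a b - F_upper b a) * wedge (nut_frame N f R x $ a) (nut_frame N f R x $ b) \<mu> \<nu>)"
    unfolding all_four
    by (simp add: ext_deriv_def partial_deriv_potential sum_four wedge_def F_upper_def
        nut_frame_zero nut_frame_nonzero nut_potential_nth(2,3))
      (simp add: f_nonzero R_nonzero sin_nonzero field_simps power2_eq_square)
  then show "ext_deriv (nut_potential A\<^sub>t A\<^sub>\<phi>) x \<mu> \<nu> = 1/2 * (\<Sum>a\<in>UNIV. \<Sum>b\<in>UNIV.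
      (F_upper a b - F_upper b a) * wedge (nut_frame N f R x $ a) (nut_frame N f R x $ b) \<mu> \<nu>)"
    for \<mu> \<nu> by blast
qed simp

end

section \<open>The supercovariant connection\<close>

lemma sum_antisym:
  fixes g :: "4 \<Rightarrow> 4 \<Rightarrow> 'a::real_vector" and c :: "4 \<Rightarrow> 4 \<Rightarrow> real"
  assumes c: "\<And>a b. c a b = - c b a" and g: "\<And>a b. g a b = - g b a"
  shows "(\<Sum>a\<in>UNIV. \<Sum>b\<in>UNIV. c a b *\<^sub>R g a b) = 2 *\<^sub>R (c 0 1 *\<^sub>R g 0 1 + c 0 2 *\<^sub>R g 0 2
    + c 0 3 *\<^sub>R g 0 3 + c 1 2 *\<^sub>R g 1 2 + c 1 3 *\<^sub>R g 1 3 + c 2 3 *\<^sub>R g 2 3)"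
proof -
  have "c b a *\<^sub>R g b a = c a b *\<^sub>R g a b" for a b
    by (simp add: c[of b a] g[of b a])
  moreover have "c a a = 0" for a
    using c[of a a] by simp
  ultimately show ?thesis
    by (simp add: sum_four scaleR_2)
qed

text \<open>One function \<open>p\<close> serves both \<open>f'\<close> and \<open>R'\<close>: in
  the BPS case f R = r - M, so f' R + f R' = 1. The function \<open>q\<close> measures the twist,
  and (u, v) are the electric and magnetic components of F rescaled by R.\<close>

locale killing_background = nut_background + clifford +
  fixes p q u v :: real
  assumes f'_eq: "f' = p / R (x $ 1)"
    and N_f_eq: "N * f (x $ 1) = - q * R (x $ 1)"
    and f_R'_eq: "f (x $ 1) * R' = 1 - p"
    and A\<^sub>t'_eq: "A\<^sub>t' = - u / R (x $ 1)"
    and A\<^sub>\<phi>_eq: "A\<^sub>\<phi> (x $ 1) = v * R (x $ 1)"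
begin

definition D :: "complex^4^4" where
  "D = mat \<i> ** (u *\<^sub>R \<gamma> 0 + v *\<^sub>R (J ** \<gamma> 0))"

text \<open>Gravity enters through p + q J and the gauge field through \<open>D\<close>. For the BPS
  solution this difference acquires the factor 1 minus an involution.\<close>

definition K :: "complex^4^4" where
  "K = p *\<^sub>R mat 1 + q *\<^sub>R J - D"

definition conn :: "4 \<Rightarrow> complex^4^4" where
  "conn \<mu> =
     (1/4) *\<^sub>R (\<Sum>a\<in>UNIV. \<Sum>b\<in>UNIV. (spin_connection (nut_frame N f R) x a b $ \<mu>) *\<^sub>R gamma2 \<gamma> a b)
     + mat (\<i> / 4)
        ** (\<Sum>a\<in>UNIV. \<Sum>b\<in>UNIV.
             flat_field_strength (nut_frame N f R) (nut_potential A\<^sub>t A\<^sub>\<phi>) x a b *\<^sub>R gamma2_up \<gamma> a b)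
        ** gamma_coord \<gamma> (nut_frame N f R) x \<mu>"

lemma sugra_deriv_eq:
  "sugra_deriv \<gamma> (nut_frame N f R) (nut_potential A\<^sub>t A\<^sub>\<phi>) \<mu> \<epsilon> x = partial_deriv \<mu> \<epsilon> x + conn \<mu> *v \<epsilon> x"
  unfolding sugra_deriv_def conn_def by (simp only: mvmult.add_left add.assoc)

lemma omega_upper_eq:
  "omega_upper a b = (let e = nut_frame N f R x in
     if a = 0 \<and> b = 1 then (p / R (x $ 1)) *\<^sub>R e $ 0
     else if a = 0 \<and> b = 2 then (q / R (x $ 1)) *\<^sub>R e $ 3
     else if a = 0 \<and> b = 3 then - ((q / R (x $ 1)) *\<^sub>R e $ 2)
     else if a = 1 \<and> b = 2 then - (((1 - p) / R (x $ 1)) *\<^sub>R e $ 2)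
     else if a = 1 \<and> b = 3 then - (((1 - p) / R (x $ 1)) *\<^sub>R e $ 3)
     else if a = 2 \<and> b = 3 then - ((cos (x $ 2) / (R (x $ 1) * sin (x $ 2))) *\<^sub>R e $ 3)
       + (q / R (x $ 1)) *\<^sub>R e $ 0
     else 0)"
  unfolding omega_upper_def using R_nonzero
  by (simp add: Let_def f'_eq N_f_eq f_R'_eq power2_eq_square)

lemma spin_sum:
  "(\<Sum>a\<in>UNIV. \<Sum>b\<in>UNIV. (spin_connection (nut_frame N f R) x a b $ \<mu>) *\<^sub>R gamma2 \<gamma> a b)
    = 2 *\<^sub>R ((omega_upper 0 1 $ \<mu>) *\<^sub>R (\<gamma> 0 ** \<gamma> 1) + (omega_upper 0 2 $ \<mu>) *\<^sub>R (\<gamma> 0 ** \<gamma> 2)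
      + (omega_upper 0 3 $ \<mu>) *\<^sub>R (\<gamma> 0 ** \<gamma> 3) + (omega_upper 1 2 $ \<mu>) *\<^sub>R (\<gamma> 1 ** \<gamma> 2)
      + (omega_upper 1 3 $ \<mu>) *\<^sub>R (\<gamma> 1 ** \<gamma> 3) + (omega_upper 2 3 $ \<mu>) *\<^sub>R (\<gamma> 2 ** \<gamma> 3))"
proof -
  have "(\<Sum>a\<in>UNIV. \<Sum>b\<in>UNIV. ((omega_upper a b - omega_upper b a) $ \<mu>) *\<^sub>R gamma2 \<gamma> a b)
    = 2 *\<^sub>R (((omega_upper 0 1 - omega_upper 1 0) $ \<mu>) *\<^sub>R gamma2 \<gamma> 0 1
      + ((omega_upper 0 2 - omega_upper 2 0) $ \<mu>) *\<^sub>R gamma2 \<gamma> 0 2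
      + ((omega_upper 0 3 - omega_upper 3 0) $ \<mu>) *\<^sub>R gamma2 \<gamma> 0 3
      + ((omega_upper 1 2 - omega_upper 2 1) $ \<mu>) *\<^sub>R gamma2 \<gamma> 1 2
      + ((omega_upper 1 3 - omega_upper 3 1) $ \<mu>) *\<^sub>R gamma2 \<gamma> 1 3
      + ((omega_upper 2 3 - omega_upper 3 2) $ \<mu>) *\<^sub>R gamma2 \<gamma> 2 3)"
    by (rule sum_antisym[OF _ gamma2_antisym]) simp
  moreover have "omega_upper 1 0 = 0" "omega_upper 2 0 = 0" "omega_upper 3 0 = 0"
    "omega_upper 2 1 = 0" "omega_upper 3 1 = 0" "omega_upper 3 2 = 0"
    by (simp_all add: omega_upper_eq)
  ultimately show ?thesis
    by (simp add: spin_connection_nut_frame gamma2_eq del: vector_minus_component)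
qed

lemma field_sum:
  "(\<Sum>a\<in>UNIV. \<Sum>b\<in>UNIV. flat_field_strength (nut_frame N f R) (nut_potential A\<^sub>t A\<^sub>\<phi>) x a b *\<^sub>R gamma2_up \<gamma> a b)
    = 2 *\<^sub>R (- ((u / R (x $ 1)) *\<^sub>R (\<gamma> 0 ** \<gamma> 1)) - (v / R (x $ 1)) *\<^sub>R (\<gamma> 2 ** \<gamma> 3))"
proof -
  have F: "F_upper a b = (if a = 0 \<and> b = 1 then u / R (x $ 1)
     else if a = 2 \<and> b = 3 then - (v / R (x $ 1)) else 0)" for a b
    unfolding F_upper_def using R_nonzero by (simp add: A\<^sub>t'_eq A\<^sub>\<phi>_eq power2_eq_square)
  have "(\<Sum>a\<in>UNIV. \<Sum>b\<in>UNIV. (F_upper a b - F_upper b a) *\<^sub>R gamma2_up \<gamma> a b)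
    = 2 *\<^sub>R ((F_upper 0 1 - F_upper 1 0) *\<^sub>R gamma2_up \<gamma> 0 1 + (F_upper 0 2 - F_upper 2 0) *\<^sub>R gamma2_up \<gamma> 0 2
      + (F_upper 0 3 - F_upper 3 0) *\<^sub>R gamma2_up \<gamma> 0 3 + (F_upper 1 2 - F_upper 2 1) *\<^sub>R gamma2_up \<gamma> 1 2
      + (F_upper 1 3 - F_upper 3 1) *\<^sub>R gamma2_up \<gamma> 1 3 + (F_upper 2 3 - F_upper 3 2) *\<^sub>R gamma2_up \<gamma> 2 3)"
    by (rule sum_antisym[OF _ gamma2_up_antisym]) simp
  then show ?thesis
    by (simp add: field_strength_nut_potential F gamma2_up_eq gamma2_eq eta_def)
qed

lemma gamma_coord_eq:
  "gamma_coord \<gamma> (nut_frame N f R) x 0 = f (x $ 1) *\<^sub>R \<gamma> 0"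
  "gamma_coord \<gamma> (nut_frame N f R) x 1 = (1 / f (x $ 1)) *\<^sub>R \<gamma> 1"
  "gamma_coord \<gamma> (nut_frame N f R) x 2 = R (x $ 1) *\<^sub>R \<gamma> 2"
  "gamma_coord \<gamma> (nut_frame N f R) x 3
    = (2 * N * cos (x $ 2)) *\<^sub>R (f (x $ 1) *\<^sub>R \<gamma> 0) + (R (x $ 1) * sin (x $ 2)) *\<^sub>R \<gamma> 3"
  by (simp_all add: gamma_coord_def sum_four nut_frame_zero nut_frame_nonzero mult_ac)

lemma mat_ii_quarter: "mat (\<i> / 4) = (1/4) *\<^sub>R mat \<i>"
  by (simp add: mat_def vec_eq_iff complex_eq_iff)

lemmas conn_simps = conn_def spin_sum field_sum gamma_coord_eq mat_ii_quarter omega_upper_eq Let_def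
  nut_frame_zero nut_frame_nonzero K_def D_def gamma5_eq clifford_simps

lemma conn_0: "conn 0 = (f (x $ 1) / (2 * R (x $ 1))) *\<^sub>R (\<gamma> 0 ** \<gamma> 1 ** K)"
  using R_nonzero by (simp add: conn_simps scaleR_right_distrib scaleR_right_diff_distrib algebra_simps)

lemma conn_1: "conn 1 = - ((1 / (2 * R (x $ 1) * f (x $ 1))) *\<^sub>R D)"
  using R_nonzero f_nonzero by (simp add: conn_simps algebra_simps)

text \<open>The summand \<open>mat 1\<close> is a charge-independent rotation, which the
  \<theta>-rotation in the ansatz compensates; all dependence on the charges sits in
  \<open>K\<close>. It originates in the 1 of f R' = 1 - p.\<close>

lemma conn_2: "conn 2 = - ((1/2) *\<^sub>R ((mat 1 - K) ** (\<gamma> 1 ** \<gamma> 2)))"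
  using R_nonzero by (simp add: conn_simps algebra_simps diff_divide_distrib)

text \<open>The leg e^0 has d\<phi> component 2 N cos \<theta> times its dt component, which
  reproduces \<open>conn 0\<close> with that factor. The rest comes from the sphere.\<close>

lemma conn_3: "conn 3 = (2 * N * cos (x $ 2)) *\<^sub>R conn 0 - (cos (x $ 2) / 2) *\<^sub>R (\<gamma> 2 ** \<gamma> 3)
    - (sin (x $ 2) / 2) *\<^sub>R ((mat 1 - K) ** (\<gamma> 1 ** \<gamma> 3))"
  using R_nonzero sin_nonzero by (simp add: conn_simps algebra_simps diff_divide_distrib)

end

section \<open>Chiral rotations and the constant involution\<close>

context clifford
begin

abbreviation rot :: "real \<Rightarrow> complex^4^4" where
  "rot c \<equiv> mat_exp (c *\<^sub>R J)"

definition reflect :: "real \<Rightarrow> complex^4^4" where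
  "reflect c = mat \<i> ** (rot c ** \<gamma> 0)"

lemmas rot_eq = mat_exp_eq[OF gamma5_squared]
lemmas rot_add = mat_exp_add[OF gamma5_squared]
lemmas rot_zero = mat_exp_zero[OF gamma5_squared]

lemma rot_add_left: "rot a ** (rot b ** X) = rot (a + b) ** X"
  by (simp only: matrix_mul_assoc rot_add)

lemma rot_commute: "A ** J = J ** A \<Longrightarrow> A ** rot c = rot c ** A"
  by (rule mat_exp_commute[OF gamma5_squared])

lemma gamma_rot: "\<gamma> a ** rot c = rot (- c) ** \<gamma> a"
  by (rule mat_exp_anticommute[OF gamma5_squared gamma5_anticommute])

lemma gamma_rot_left: "\<gamma> a ** (rot c ** X) = rot (- c) ** (\<gamma> a ** X)"
  by (simp only: matrix_mul_assoc gamma_rot)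

text \<open>Moving \<gamma>_0 past the rotation inverts its angle, so the rotations cancel, and the
  two signs i^2 = -1 and \<gamma>_0^2 = -1 cancel as well.\<close>

lemma reflect_squared: "reflect c ** reflect c = mat 1"
proof -
  have "reflect c ** reflect c = mat \<i> ** (mat \<i> ** (rot c ** (\<gamma> 0 ** (rot c ** \<gamma> 0))))"
    by (simp only: reflect_def matrix_mul_assoc[symmetric] mat_commute_left[of "rot c"] mat_commute_left[of "\<gamma> 0"])
  also have "\<dots> = mat 1"
    by (simp only: gamma_rot_left rot_add_left gamma_squared mat_ii_squared_left)
      (simp only: mat_ring add.right_inverse rot_zero simp_thms if_True minus_minus)
  finally show ?thesis .
qed

lemma rot_reflect: "rot a ** reflect c = reflect (a + c)"
  by (simp only: reflect_def mat_commute_left[of "rot a"] rot_add_left)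

lemma reflect_rot: "reflect c ** rot a = reflect (c - a)"
  by (simp only: reflect_def matrix_mul_assoc[symmetric] gamma_rot rot_add_left) simp

lemma reflect_gamma5: "reflect c ** J = - (J ** reflect c)"
proof -
  have "reflect c ** J = - (mat \<i> ** (rot c ** (J ** \<gamma> 0)))"
    by (simp add: reflect_def mat_ring gamma5_anticommute)
  also have "rot c ** (J ** \<gamma> 0) = J ** (rot c ** \<gamma> 0)"
    by (simp only: matrix_mul_assoc rot_commute[OF refl])
  finally show ?thesis
    by (simp only: reflect_def mat_commute_left[of J])
qed

lemma reflect_commute:
  assumes "A ** \<gamma> 0 = \<gamma> 0 ** A" and "A ** J = J ** A"
  shows "A ** reflect c = reflect c ** A"
proof -
  have "A ** reflect c = mat \<i> ** ((A ** rot c) ** \<gamma> 0)"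
    by (simp only: reflect_def mat_commute_left[of A] matrix_mul_assoc[symmetric])
  also have "\<dots> = reflect c ** A"
    by (simp only: rot_commute[OF assms(2)] reflect_def matrix_mul_assoc[symmetric] assms(1))
  finally show ?thesis .
qed

lemma gamma2_gamma0: "a \<noteq> 0 \<Longrightarrow> b \<noteq> 0 \<Longrightarrow> gamma2 \<gamma> a b ** \<gamma> 0 = \<gamma> 0 ** gamma2 \<gamma> a b"
  by (simp add: gamma2_def mat_ring gamma_commute[of _ 0] gamma_commute_left[of _ 0])

lemma dim_reflect_eigenspace: "vec.dim {v. reflect c *v v = v} = 2"
proof -
  let ?V = "{v. reflect c *v v = v}" and ?W = "{v. reflect c *v v = - v}"
  have V: "vec.subspace ?V" and W: "vec.subspace ?W"
    by (auto simp: vec.subspace_def mvmult.zero_right mvmult.add_right matrix_scale_commute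
        vec.scale_minus_right)
  have JJ: "J *v (J *v v) = - v" for v
    by (simp add: matrix_vector_mul_assoc gamma5_squared vec_ring)
  have RJ: "reflect c *v (J *v v) = - (J *v (reflect c *v v))" for v
    by (simp add: matrix_vector_mul_assoc reflect_gamma5 mvmult.minus_left)
  have RR: "reflect c *v (reflect c *v v) = v" for v
    by (simp add: matrix_vector_mul_assoc reflect_squared)
  have W_eq: "?W = (*v) J ` ?V"
  proof (intro equalityI subsetI)
    fix v assume "v \<in> ?W"
    then have "v = J *v (J *v (- v))" "J *v (- v) \<in> ?V"
      by (simp_all add: JJ RJ mvmult.minus_right)
    then show "v \<in> (*v) J ` ?V"
      by blast
  qed (auto simp: RJ)
  have "inj ((*v) J)"
    by (rule inj_on_inverseI[of _ "\<lambda>v. - (J *v v)"]) (simp add: JJ)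
  then have "vec.dim ?W = vec.dim ?V"
    unfolding W_eq
    using vec.dim_image_eq[OF matrix_vector_mul_linear_gen inj_on_subset[OF _ subset_UNIV]] by blast
  moreover have "{x + y |x y. x \<in> ?V \<and> y \<in> ?W} = UNIV"
  proof -
    have "v \<in> {x + y |x y. x \<in> ?V \<and> y \<in> ?W}" for v
    proof -
      have "v = (1/2) *\<^sub>R (v + reflect c *v v) + (1/2) *\<^sub>R (v - reflect c *v v)"
        by (simp add: algebra_simps flip: scaleR_2 scaleR_left_distrib)
      moreover have "(1/2) *\<^sub>R (v + reflect c *v v) \<in> ?V" "(1/2) *\<^sub>R (v - reflect c *v v) \<in> ?W"
        by (simp_all add: vec_ring(1-10) RR algebra_simps)
      ultimately show ?thesis
        by blast
    qed
    then show ?thesis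
      by blast
  qed
  moreover have "?V \<inter> ?W = {0}"
  proof -
    have "v = 0" if "v \<in> ?V \<inter> ?W" for v
    proof -
      have "reflect c *v v = v" "reflect c *v v = - v"
        using that by blast+
      then have "v = - v"
        by (rule trans[OF sym])
      then have "v $ i = - (v $ i)" for i
        by (metis vector_uminus_component)
      then show ?thesis
        by (simp add: vec_eq_iff)
    qed
    then show ?thesis
      by (auto simp: mvmult.zero_right)
  qed
  ultimately have "vec.dim (UNIV :: (complex^4) set) + vec.dim {0 :: complex^4} = vec.dim ?V + vec.dim ?V"
    using vec.dim_sums_Int[OF V W] by simp
  then show ?thesis
    by (simp add: vec.dim_UNIV card_cart_basis)
qed

end

section \<open>The BPS background\<close>

lemma Rad_squared: "(Rad N r)\<^sup>2 = r\<^sup>2 + N\<^sup>2"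
  by (simp add: Rad_def)

lemma Rad_pos: "r > 0 \<Longrightarrow> Rad N r > 0"
  by (simp add: Rad_def add_pos_nonneg)

lemma DERIV_Rad:
  assumes "r > 0"
  shows "(Rad N has_real_derivative r / Rad N r) (at r)"
proof -
  have "r\<^sup>2 + N\<^sup>2 > 0"
    using assms by (simp add: add_pos_nonneg)
  then have "((\<lambda>r. sqrt (r\<^sup>2 + N\<^sup>2)) has_real_derivative r / sqrt (r\<^sup>2 + N\<^sup>2)) (at r)"
    by (auto intro!: derivative_eq_intros simp: field_simps)
  then show ?thesis
    by (simp add: Rad_def[abs_def])
qed

locale bps_taub_nut = clifford +
  fixes M N Q H Z :: real and \<beta> :: "real \<Rightarrow> real" and \<alpha>\<^sub>m \<alpha>\<^sub>q :: real
  assumes Z_pos: "Z > 0"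
    and mass_BPS: "M\<^sup>2 + N\<^sup>2 = Z\<^sup>2"
    and beta: "\<And>r. r > max M 0 \<Longrightarrow>
       - pi / 2 < \<beta> r \<and> \<beta> r < pi / 2 \<and> cos (\<beta> r) = r / Rad N r \<and> sin (\<beta> r) = N / Rad N r"
    and cos_\<alpha>\<^sub>m: "cos \<alpha>\<^sub>m = M / Z" and sin_\<alpha>\<^sub>m: "sin \<alpha>\<^sub>m = N / Z"
    and cos_\<alpha>\<^sub>q: "cos \<alpha>\<^sub>q = Q / Z" and sin_\<alpha>\<^sub>q: "sin \<alpha>\<^sub>q = H / Z"
begin

section \<open>Radial functions of the Taub-NUT solution\<close>

definition "f r = sqrt (lam M N Z r) / Rad N r"
definition "A\<^sub>t r = (Q * r + N * H) / (Rad N r)\<^sup>2"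
definition "A\<^sub>\<phi> r = (- H * (r\<^sup>2 - N\<^sup>2) + 2 * N * Q * r) / (Rad N r)\<^sup>2"
text \<open>Real and J-parts of (r + N J)(M - N J)/R^2 for \<open>p\<close>, \<open>q\<close>, and
  of (r + N J)^2 (Q - H J)/R^3 for \<open>u\<close>, \<open>v\<close>.\<close>

definition "p r = (r * M + N\<^sup>2) / (Rad N r)\<^sup>2"
definition "q r = N * (M - r) / (Rad N r)\<^sup>2"
definition "u r = ((r\<^sup>2 - N\<^sup>2) * Q + 2 * r * N * H) / (Rad N r) ^ 3"
definition "v r = (2 * r * N * Q - (r\<^sup>2 - N\<^sup>2) * H) / (Rad N r) ^ 3"

lemma vielbein_eq: "vielbein M N Z = nut_frame N f (Rad N)"
  by (simp add: fun_eq_iff vielbein_def nut_frame_def Let_def f_def vec_eq_iff)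

lemma gauge_potential_eq: "gauge_potential N Q H = nut_potential A\<^sub>t A\<^sub>\<phi>"
  by (simp add: fun_eq_iff gauge_potential_def nut_potential_def Let_def A\<^sub>t_def A\<^sub>\<phi>_def)

lemma f_eq: "r > M \<Longrightarrow> f r = (r - M) / Rad N r"
  by (simp add: f_def lam_BPS[OF mass_BPS])

lemma f_pos: "r > max M 0 \<Longrightarrow> f r > 0"
  by (simp add: f_eq Rad_pos)

lemma DERIV_f:
  assumes "r > max M 0"
  shows "(f has_real_derivative p r / Rad N r) (at r)"
\<comment> \<open>The square root of \<lambda> = (r - M)^2 is r - M only to the right of M, so the
  derivative is transferred from (r - M)/R along an open half-line.\<close>
proof (rule has_field_derivative_transform_within_open)
  have "Rad N r > 0"
    using assms by (intro Rad_pos) simp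
  moreover have "(Rad N r - (r - M) * (r / Rad N r)) / (Rad N r * Rad N r) = p r / Rad N r"
    using \<open>Rad N r > 0\<close> Rad_squared[of N r] assms
    by (simp add: p_def divide_simps) (simp add: power2_eq_square algebra_simps)
  ultimately show "((\<lambda>r. (r - M) / Rad N r) has_real_derivative p r / Rad N r) (at r)"
    using assms by (auto intro!: derivative_eq_intros DERIV_Rad)
qed (use assms in \<open>auto simp: f_eq intro: open_greaterThan[of "max M 0"]\<close>)

lemma DERIV_A\<^sub>t:
  assumes "r > 0"
  shows "(A\<^sub>t has_real_derivative - u r / Rad N r) (at r)"
proof -
  have pos: "r\<^sup>2 + N\<^sup>2 > 0"
    using assms by (simp add: add_pos_nonneg)
  have R4: "Rad N r ^ 3 * Rad N r = (r\<^sup>2 + N\<^sup>2)\<^sup>2"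
    using Rad_squared[of N r] by (simp add: power2_eq_square power3_eq_cube mult_ac)
  have "((\<lambda>r. (Q * r + N * H) / (r\<^sup>2 + N\<^sup>2)) has_real_derivative
      (Q * (r\<^sup>2 + N\<^sup>2) - (Q * r + N * H) * (2 * r)) / (r\<^sup>2 + N\<^sup>2)\<^sup>2) (at r)"
    using pos by (auto intro!: derivative_eq_intros simp: power2_eq_square)
  also have "(Q * (r\<^sup>2 + N\<^sup>2) - (Q * r + N * H) * (2 * r)) / (r\<^sup>2 + N\<^sup>2)\<^sup>2 = - u r / Rad N r"
    unfolding u_def minus_divide_left divide_divide_eq_left R4
    by (simp add: power2_eq_square algebra_simps)
  finally show ?thesis
    by (simp add: A\<^sub>t_def[abs_def] Rad_squared)
qed

text \<open>The factor 2 N reflects the identity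
  \<open>A\<^sub>\<phi> r = 2 * N * A\<^sub>t r - H\<close>.\<close>

lemma DERIV_A\<^sub>\<phi>:
  assumes "r > 0"
  shows "(A\<^sub>\<phi> has_real_derivative 2 * N * (- u r / Rad N r)) (at r)"
proof -
  have pos: "r\<^sup>2 + N\<^sup>2 > 0"
    using assms by (simp add: add_pos_nonneg)
  have R4: "Rad N r ^ 3 * Rad N r = (r\<^sup>2 + N\<^sup>2)\<^sup>2"
    using Rad_squared[of N r] by (simp add: power2_eq_square power3_eq_cube mult_ac)
  let ?n = "- H * (r\<^sup>2 - N\<^sup>2) + 2 * N * Q * r"
  have "((\<lambda>r. (- H * (r\<^sup>2 - N\<^sup>2) + 2 * N * Q * r) / (r\<^sup>2 + N\<^sup>2)) has_real_derivative
      ((- H * (2 * r) + 2 * N * Q) * (r\<^sup>2 + N\<^sup>2) - ?n * (2 * r)) / (r\<^sup>2 + N\<^sup>2)\<^sup>2) (at r)"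
    using pos by (auto intro!: derivative_eq_intros simp: power2_eq_square)
  also have "((- H * (2 * r) + 2 * N * Q) * (r\<^sup>2 + N\<^sup>2) - ?n * (2 * r)) / (r\<^sup>2 + N\<^sup>2)\<^sup>2
      = 2 * N * (- u r / Rad N r)"
    unfolding u_def minus_divide_left divide_divide_eq_left R4 times_divide_eq_right
    by (simp add: power2_eq_square algebra_simps)
  finally show ?thesis
    by (simp add: A\<^sub>\<phi>_def[abs_def] Rad_squared)
qed

text \<open>\<beta> is specified only by its sine, cosine and range. For r > 0 these identify it
  with arctan (N / r), from which differentiability follows.\<close>

lemma DERIV_beta:
  assumes "r > max M 0"
  shows "(\<beta> has_real_derivative - N / (Rad N r)\<^sup>2) (at r)"
proof (rule has_field_derivative_transform_within_open)
  have "r > 0"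
    using assms by simp
  then have "inverse (1 + (N / r)\<^sup>2) * (- N / r\<^sup>2) = - N / (r\<^sup>2 + N\<^sup>2)"
    by (simp add: field_simps add_nonneg_eq_0_iff)
  moreover have "((\<lambda>r. arctan (N / r)) has_real_derivative inverse (1 + (N / r)\<^sup>2) * (- N / r\<^sup>2)) (at r)"
    using \<open>r > 0\<close> by (auto intro!: derivative_eq_intros simp: power2_eq_square)
  ultimately show "((\<lambda>r. arctan (N / r)) has_real_derivative - N / (Rad N r)\<^sup>2) (at r)"
    by (simp add: Rad_squared)
  show "arctan (N / s) = \<beta> s" if "s \<in> {max M 0<..}" for s
  proof -
    have "tan (\<beta> s) = N / s"
      using beta[of s] that Rad_pos[of s N] by (simp add: tan_def)
    then show ?thesis
      using beta[of s] that by (intro arctan_unique) auto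
  qed
qed (use assms in auto)

lemma background:
  assumes "x \<in> region M"
  shows "killing_background N f (Rad N) A\<^sub>t A\<^sub>\<phi> x (p (x $ 1) / Rad N (x $ 1)) (x $ 1 / Rad N (x $ 1))
    (- u (x $ 1) / Rad N (x $ 1)) \<gamma> (p (x $ 1)) (q (x $ 1)) (u (x $ 1)) (v (x $ 1))"
proof -
  let ?r = "x $ 1"
  have r: "?r > max M 0" "?r > M" "?r > 0" and th: "0 < x $ 2" "x $ 2 < pi"
    using assms by (auto simp: region_def)
  have R: "Rad N ?r > 0" and R2: "Rad N ?r * Rad N ?r = ?r * ?r + N * N"
    using Rad_pos[OF r(3)] Rad_squared[of N ?r] by (simp_all add: power2_eq_square)
  show ?thesis
  proof
    show "(f has_real_derivative p ?r / Rad N ?r) (at ?r)"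
      by (rule DERIV_f[OF r(1)])
    show "(Rad N has_real_derivative ?r / Rad N ?r) (at ?r)"
      by (rule DERIV_Rad[OF r(3)])
    show "(A\<^sub>t has_real_derivative - u ?r / Rad N ?r) (at ?r)"
      by (rule DERIV_A\<^sub>t[OF r(3)])
    show "(A\<^sub>\<phi> has_real_derivative 2 * N * (- u ?r / Rad N ?r)) (at ?r)"
      by (rule DERIV_A\<^sub>\<phi>[OF r(3)])
    show "f ?r \<noteq> 0" "Rad N ?r \<noteq> 0" "sin (x $ 2) \<noteq> 0"
      using f_pos[OF r(1)] R sin_gt_zero[OF th] by simp_all
    show "N * f ?r = - q ?r * Rad N ?r"
      using R by (simp add: q_def f_eq[OF r(2)] power2_eq_square divide_simps) (simp add: algebra_simps)
    show "f ?r * (?r / Rad N ?r) = 1 - p ?r"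
      using R R2 r(3) by (simp add: p_def f_eq[OF r(2)] power2_eq_square divide_simps algebra_simps)
    show "A\<^sub>\<phi> ?r = v ?r * Rad N ?r"
      using R by (simp add: A\<^sub>\<phi>_def v_def power2_eq_square power3_eq_cube divide_simps algebra_simps)
  qed (rule refl)+
qed

end

section \<open>The gauge transformation to constant spinors\<close>

text \<open>The \<phi>-derivative of the spinor produces \<gamma>_23 to the right of the
  \<theta>-rotation. Conjugation by a half-angle spin rotation turns it through the full angle in
  the 1-2 plane.\<close>

lemma (in clifford) frame_rotation:
  "mat_exp ((\<theta> / 2) *\<^sub>R gamma2 \<gamma> 1 2) ** gamma2 \<gamma> 2 3
    = (cos \<theta> *\<^sub>R gamma2 \<gamma> 2 3 + sin \<theta> *\<^sub>R gamma2 \<gamma> 1 3) ** mat_exp ((\<theta> / 2) *\<^sub>R gamma2 \<gamma> 1 2)"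
proof -
  \<comment> \<open>Writing the half angle as \<theta> - \<theta>/2 splits off the full-angle
    coefficients directly.\<close>
  have c: "cos (\<theta> / 2) = cos \<theta> * cos (\<theta> / 2) + sin \<theta> * sin (\<theta> / 2)"
    using cos_diff[of \<theta> "\<theta> / 2"] by simp
  have s: "sin (\<theta> / 2) = sin \<theta> * cos (\<theta> / 2) - cos \<theta> * sin (\<theta> / 2)"
    using sin_diff[of \<theta> "\<theta> / 2"] by simp
  have "mat_exp ((\<theta> / 2) *\<^sub>R gamma2 \<gamma> 1 2) ** gamma2 \<gamma> 2 3
      = cos (\<theta> / 2) *\<^sub>R (\<gamma> 2 ** \<gamma> 3) + sin (\<theta> / 2) *\<^sub>R (\<gamma> 1 ** \<gamma> 3)"
    by (simp add: mat_exp_eq gamma2_squared) (simp add: gamma2_eq clifford_simps)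
  also have "\<dots> = (cos \<theta> * cos (\<theta> / 2) + sin \<theta> * sin (\<theta> / 2)) *\<^sub>R (\<gamma> 2 ** \<gamma> 3)
      + (sin \<theta> * cos (\<theta> / 2) - cos \<theta> * sin (\<theta> / 2)) *\<^sub>R (\<gamma> 1 ** \<gamma> 3)"
    by (simp only: c[symmetric] s[symmetric])
  also have "\<dots> = (cos \<theta> *\<^sub>R gamma2 \<gamma> 2 3 + sin \<theta> *\<^sub>R gamma2 \<gamma> 1 3) ** mat_exp ((\<theta> / 2) *\<^sub>R gamma2 \<gamma> 1 2)"
    by (simp add: mat_exp_eq gamma2_squared) (simp add: gamma2_eq clifford_simps algebra_simps)
  finally show ?thesis .
qed

context bps_taub_nut
begin

abbreviation "\<gamma>12 \<equiv> gamma2 \<gamma> 1 2"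
abbreviation "\<gamma>23 \<equiv> gamma2 \<gamma> 2 3"

definition theta_rot :: "real^4 \<Rightarrow> complex^4^4" where
  "theta_rot y = mat_exp ((y $ 2 / 2) *\<^sub>R \<gamma>12)"

definition phi_rot :: "real^4 \<Rightarrow> complex^4^4" where
  "phi_rot y = mat_exp ((y $ 3 / 2) *\<^sub>R \<gamma>23)"

definition radial :: "real^4 \<Rightarrow> complex^4^4" where
  "radial y = sqrt ((y $ 1 - M) / Rad N (y $ 1)) *\<^sub>R rot (\<beta> (y $ 1) / 2)"

definition U :: "real^4 \<Rightarrow> complex^4^4" where
  "U y = theta_rot y ** (phi_rot y ** radial y)"

definition C :: "real^4 \<Rightarrow> complex^4^4" where
  "C y = p (y $ 1) *\<^sub>R mat 1 + q (y $ 1) *\<^sub>R J"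

definition \<Pi>\<^sub>0 :: "complex^4^4" where
  "\<Pi>\<^sub>0 = reflect (\<alpha>\<^sub>m - \<alpha>\<^sub>q)"

text \<open>The logarithmic derivative (d_\<mu> U) U^-1; its \<phi> entry is \<gamma>_23 / 2
  conjugated by \<open>theta_rot\<close>.\<close>

definition U_deriv :: "real^4 \<Rightarrow> 4 \<Rightarrow> complex^4^4" where
  "U_deriv x \<mu> = (if \<mu> = 1 then (1 / (2 * Rad N (x $ 1) * f (x $ 1))) *\<^sub>R C x
     else if \<mu> = 2 then (1/2) *\<^sub>R \<gamma>12
     else if \<mu> = 3 then (1/2) *\<^sub>R (cos (x $ 2) *\<^sub>R \<gamma>23 + sin (x $ 2) *\<^sub>R gamma2 \<gamma> 1 3) else 0)"

lemma commute_gamma5: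
  "theta_rot y ** J = J ** theta_rot y" "phi_rot y ** J = J ** phi_rot y" "radial y ** J = J ** radial y"
  "C y ** J = J ** C y"
  unfolding theta_rot_def phi_rot_def radial_def C_def
  by (simp_all add: mat_exp_eq gamma2_squared gamma5_squared mat_ring gamma2_gamma5)

lemma commute_gamma0:
  "theta_rot y ** \<gamma> 0 = \<gamma> 0 ** theta_rot y" "phi_rot y ** \<gamma> 0 = \<gamma> 0 ** phi_rot y"
  unfolding theta_rot_def phi_rot_def
  by (simp_all add: mat_exp_eq gamma2_squared mat_ring gamma2_gamma0)

lemma C_commute:
  assumes "A ** J = J ** A"
  shows "A ** C y = C y ** A"
  by (simp add: C_def mat_ring assms)

lemma has_derivative_radial_factors:
  assumes x: "x \<in> region M"
  shows "((\<lambda>y. sqrt ((y $ 1 - M) / Rad N (y $ 1))) has_derivative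
      (\<lambda>h. p (x $ 1) / Rad N (x $ 1) / (2 * sqrt (f (x $ 1))) * h $ 1)) (at x)"
    and "((\<lambda>y. \<beta> (y $ 1) / 2) has_derivative (\<lambda>h. - N / (Rad N (x $ 1))\<^sup>2 / 2 * h $ 1)) (at x)"
proof -
  let ?r = "x $ 1"
  let ?s = "\<lambda>r. (r - M) / Rad N r"
  have r: "?r > max M 0" "?r > M"
    using x by (auto simp: region_def)
  have s: "?s ?r = f ?r" and fpos: "f ?r > 0"
    using f_eq[OF r(2)] f_pos[OF r(1)] by simp_all
  have "(?s has_real_derivative p ?r / Rad N ?r) (at ?r)"
    by (rule has_field_derivative_transform_within_open[OF DERIV_f[OF r(1)] open_greaterThan[of M]])
      (use r(2) in \<open>auto simp: f_eq\<close>)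
  then have "((\<lambda>r. sqrt (?s r)) has_real_derivative inverse (sqrt (?s ?r)) / 2 * (p ?r / Rad N ?r)) (at ?r)"
    using fpos s by (intro DERIV_chain2[OF DERIV_real_sqrt]) simp_all
  then have "((\<lambda>r. sqrt (?s r)) has_real_derivative p ?r / Rad N ?r / (2 * sqrt (f ?r))) (at ?r)"
    unfolding s by (simp add: field_simps)
  then show "((\<lambda>y. sqrt (?s (y $ 1))) has_derivative (\<lambda>h. p ?r / Rad N ?r / (2 * sqrt (f ?r)) * h $ 1)) (at x)"
    by (rule has_derivative_coordinate)
  have "((\<lambda>r. \<beta> r / 2) has_real_derivative - N / (Rad N ?r)\<^sup>2 / 2) (at ?r)"
    by (rule DERIV_cdivide[OF DERIV_beta[OF r(1)]])
  then show "((\<lambda>y. \<beta> (y $ 1) / 2) has_derivative (\<lambda>h. - N / (Rad N ?r)\<^sup>2 / 2 * h $ 1)) (at x)"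
    by (rule has_derivative_coordinate)
qed

text \<open>The logarithmic derivative is f'/(2 f) + (\<beta>'/2) J. Since f' = p/R and \<beta>' =
  -N/R^2 = q/(R f), both parts share the factor 1/(2 R f) and combine to \<open>C\<close>;
  \<open>c1\<close> and \<open>c2\<close> are these two identities.\<close>

lemma has_derivative_radial:
  assumes x: "x \<in> region M"
  shows "(radial has_derivative (\<lambda>h. h $ 1 *\<^sub>R ((1 / (2 * Rad N (x $ 1) * f (x $ 1))) *\<^sub>R (C x ** radial x)))) (at x)"
proof -
  let ?r = "x $ 1"
  let ?s = "\<lambda>r. (r - M) / Rad N r"
  have r: "?r > max M 0" "?r > M" "?r > 0"
    using x by (auto simp: region_def)
  have R: "Rad N ?r > 0"
    using Rad_pos[OF r(3)] .
  have s: "?s ?r = f ?r" and fpos: "f ?r > 0"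
    using f_eq[OF r(2)] f_pos[OF r(1)] by simp_all
  note 1 = has_derivative_radial_factors(1)[OF x]
  have 2: "((\<lambda>y. rot (\<beta> (y $ 1) / 2)) has_derivative
      (\<lambda>h. (- N / (Rad N ?r)\<^sup>2 / 2 * h $ 1) *\<^sub>R (J ** rot (\<beta> ?r / 2)))) (at x)"
    by (rule has_derivative_mat_exp[OF gamma5_squared has_derivative_radial_factors(2)[OF x]])
  have c1: "p ?r / Rad N ?r / (2 * sqrt (f ?r)) = 1 / (2 * Rad N ?r * f ?r) * p ?r * sqrt (f ?r)"
  proof -
    have "f ?r = sqrt (f ?r) * sqrt (f ?r)"
      using fpos by simp
    then show ?thesis
      using fpos R by (simp add: divide_simps)
  qed
  have c2: "sqrt (f ?r) * (- N / (Rad N ?r)\<^sup>2 / 2) = 1 / (2 * Rad N ?r * f ?r) * q ?r * sqrt (f ?r)"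
    using R r(2) unfolding q_def f_eq[OF r(2)]
    by (simp add: power2_eq_square divide_simps) (simp add: algebra_simps)
  have "(\<lambda>h::real^4. sqrt (?s ?r) *\<^sub>R ((- N / (Rad N ?r)\<^sup>2 / 2 * h $ 1) *\<^sub>R (J ** rot (\<beta> ?r / 2)))
      + (p ?r / Rad N ?r / (2 * sqrt (f ?r)) * h $ 1) *\<^sub>R rot (\<beta> ?r / 2))
    = (\<lambda>h. h $ 1 *\<^sub>R ((1 / (2 * Rad N ?r * f ?r)) *\<^sub>R (C x ** radial x)))" (is "?L = _")
  proof
    fix h :: "real^4"
    have "?L h = h $ 1 *\<^sub>R ((sqrt (f ?r) * (- N / (Rad N ?r)\<^sup>2 / 2)) *\<^sub>R (J ** rot (\<beta> ?r / 2))
      + (p ?r / Rad N ?r / (2 * sqrt (f ?r))) *\<^sub>R rot (\<beta> ?r / 2))"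
      unfolding s scaleR_add_right scaleR_scaleR by (simp only: mult_ac)
    also have "\<dots> = h $ 1 *\<^sub>R ((1 / (2 * Rad N ?r * f ?r)) *\<^sub>R (C x ** radial x))"
      unfolding c1 c2 by (simp add: C_def radial_def s mat_ring scaleR_add_right mult_ac)
    finally show "?L h = h $ 1 *\<^sub>R ((1 / (2 * Rad N ?r * f ?r)) *\<^sub>R (C x ** radial x))" .
  qed
  with has_derivative_scaleR[OF 1 2] show ?thesis
    unfolding radial_def[abs_def] by (simp only:)
qed

lemma has_derivative_U:
  assumes x: "x \<in> region M"
  shows "(U has_derivative (\<lambda>h. \<Sum>\<mu>\<in>UNIV. h $ \<mu> *\<^sub>R (U_deriv x \<mu> ** U x))) (at x)"
proof -
  have "((\<lambda>y. y $ i / 2) has_derivative (\<lambda>h. h $ i / 2)) (at x)" for i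
    using has_derivative_coordinate[OF DERIV_cdivide[OF DERIV_ident, of 2], where x = x and i = i] by simp
  then have 1: "(theta_rot has_derivative (\<lambda>h. (h $ 2 / 2) *\<^sub>R (\<gamma>12 ** theta_rot x))) (at x)"
    and 2: "(phi_rot has_derivative (\<lambda>h. (h $ 3 / 2) *\<^sub>R (\<gamma>23 ** phi_rot x))) (at x)"
    unfolding theta_rot_def phi_rot_def
    by (intro has_derivative_mat_exp gamma2_squared; simp)+
  have C: "theta_rot x ** (phi_rot x ** (C x ** radial x)) = C x ** U x"
    by (simp add: U_def matrix_mul_assoc C_commute commute_gamma5)
  have T: "theta_rot x ** (\<gamma>23 ** X)
      = (cos (x $ 2) *\<^sub>R \<gamma>23 + sin (x $ 2) *\<^sub>R gamma2 \<gamma> 1 3) ** (theta_rot x ** X)" for X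
    unfolding theta_rot_def by (simp only: matrix_mul_assoc frame_rotation)
  have "(\<lambda>h::real^4. theta_rot x ** (phi_rot x ** (h $ 1 *\<^sub>R ((1 / (2 * Rad N (x $ 1) * f (x $ 1))) *\<^sub>R (C x ** radial x)))
        + ((h $ 3 / 2) *\<^sub>R (\<gamma>23 ** phi_rot x)) ** radial x)
      + ((h $ 2 / 2) *\<^sub>R (\<gamma>12 ** theta_rot x)) ** (phi_rot x ** radial x))
    = (\<lambda>h. \<Sum>\<mu>\<in>UNIV. h $ \<mu> *\<^sub>R (U_deriv x \<mu> ** U x))"
    unfolding mmult.add_right mmult.scaleR_left mmult.scaleR_right C matrix_mul_assoc[symmetric] T
    by (simp add: fun_eq_iff sum_four U_deriv_def U_def mat_ring)
  with mmult.FDERIV[OF 1 mmult.FDERIV[OF 2 has_derivative_radial[OF x]]] show ?thesis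
    unfolding U_def[abs_def] by (simp only:)
qed

lemma C_eq:
  assumes "x \<in> region M"
  shows "C x = (Z / Rad N (x $ 1)) *\<^sub>R rot (\<beta> (x $ 1) - \<alpha>\<^sub>m)"
proof -
  let ?r = "x $ 1"
  have r: "?r > max M 0" "?r > 0"
    using assms by (auto simp: region_def)
  have "p ?r = Z / Rad N ?r * cos (\<beta> ?r - \<alpha>\<^sub>m)" "q ?r = Z / Rad N ?r * sin (\<beta> ?r - \<alpha>\<^sub>m)"
    using beta[OF r(1)] Rad_pos[OF r(2), of N] Z_pos
    by (simp_all add: p_def q_def cos_diff sin_diff cos_\<alpha>\<^sub>m sin_\<alpha>\<^sub>m power2_eq_square divide_simps)
      (simp_all add: algebra_simps)
  then show ?thesis
    unfolding C_def rot_eq by (simp only: scaleR_add_right scaleR_scaleR)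
qed

end

lemma sum_axis_scaleR: "(\<Sum>\<nu>\<in>UNIV. (axis \<mu> 1 :: real^4) $ \<nu> *\<^sub>R X \<nu>) = X \<mu>" for X :: "4 \<Rightarrow> 'a::real_vector"
proof -
  have "(\<Sum>\<nu>\<in>UNIV. (axis \<mu> 1 :: real^4) $ \<nu> *\<^sub>R X \<nu>) = (\<Sum>\<nu>\<in>UNIV. if \<nu> = \<mu> then X \<nu> else 0)"
    by (intro sum.cong) (auto simp: axis_def)
  then show ?thesis
    by simp
qed

context bps_taub_nut
begin

text \<open>The left factor of \<open>K\<close> that remains after the gauge transformation. Its r
  entry is a multiple of the identity and its \<theta> entry is \<gamma>_12 / 2, which makes these
  two equations the convenient ones for the converse.\<close>

definition drift :: "real^4 \<Rightarrow> 4 \<Rightarrow> complex^4^4" where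
  "drift x \<mu> = (let k = f (x $ 1) / (2 * Rad N (x $ 1)) in
     if \<mu> = 0 then k *\<^sub>R (\<gamma> 0 ** \<gamma> 1)
     else if \<mu> = 1 then (1 / (2 * Rad N (x $ 1) * f (x $ 1))) *\<^sub>R mat 1
     else if \<mu> = 2 then (1/2) *\<^sub>R \<gamma>12
     else (2 * N * cos (x $ 2) * k) *\<^sub>R (\<gamma> 0 ** \<gamma> 1) + (sin (x $ 2) / 2) *\<^sub>R gamma2 \<gamma> 1 3)"

text \<open>Passing \<open>rot (\<beta> / 2)\<close> from one side of a reflection to the other
  shifts its angle by \<beta>, which removes the r-dependence. The spatial rotations commute with
  \<gamma>_0 and J and change nothing.\<close>

lemma reflect_U: "reflect (\<beta> (x $ 1) - \<alpha>\<^sub>q + \<alpha>\<^sub>m) ** U x = U x ** \<Pi>\<^sub>0"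
proof -
  let ?c = "\<beta> (x $ 1) - \<alpha>\<^sub>q + \<alpha>\<^sub>m"
  have "reflect ?c ** radial x = radial x ** \<Pi>\<^sub>0"
    by (simp add: radial_def \<Pi>\<^sub>0_def mat_ring reflect_rot rot_reflect algebra_simps)
  moreover have "theta_rot x ** reflect ?c = reflect ?c ** theta_rot x"
    "phi_rot x ** reflect ?c = reflect ?c ** phi_rot x"
    by (intro reflect_commute commute_gamma0 commute_gamma5)+
  ultimately show ?thesis
    unfolding U_def by (metis (no_types) matrix_mul_assoc)
qed

lemma sugra_deriv_gauge:
  assumes x: "x \<in> region M" and \<eta>: "(\<eta> has_derivative \<eta>') (at x)"
  shows "sugra_deriv \<gamma> (vielbein M N Z) (gauge_potential N Q H) \<mu> (\<lambda>y. U y *v \<eta> y) x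
    = U x *v \<eta>' (axis \<mu> 1) + drift x \<mu> *v (C x *v (U x *v ((mat 1 - \<Pi>\<^sub>0) *v \<eta> x)))"
proof -
  let ?r = "x $ 1"
  interpret kb: killing_background N f "Rad N" A\<^sub>t A\<^sub>\<phi> x "p ?r / Rad N ?r" "?r / Rad N ?r"
    "- u ?r / Rad N ?r" \<gamma> "p ?r" "q ?r" "u ?r" "v ?r"
    by (rule background[OF x])
  have r: "?r > max M 0" "?r > 0"
    using x by (auto simp: region_def)
  have R: "Rad N ?r > 0"
    using Rad_pos[OF r(2)] .
  let ?c = "\<beta> ?r - \<alpha>\<^sub>q + \<alpha>\<^sub>m"
  \<comment> \<open>The charge number u + v J is (Z/R) e^((2 \<beta> - \<alpha>_q) J). It has the
    modulus of \<open>C\<close>, and splitting the angle as (\<beta> - \<alpha>_m) + (\<beta> -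
    \<alpha>_q + \<alpha>_m) factors \<open>C\<close> out.\<close>
  have "kb.D = (Z / Rad N ?r) *\<^sub>R reflect (2 * \<beta> ?r - \<alpha>\<^sub>q)"
  proof -
    have "u ?r = Z / Rad N ?r * cos (2 * \<beta> ?r - \<alpha>\<^sub>q)" "v ?r = Z / Rad N ?r * sin (2 * \<beta> ?r - \<alpha>\<^sub>q)"
      using beta[OF r(1)] R Z_pos
      by (simp_all add: u_def v_def cos_diff sin_diff cos_\<alpha>\<^sub>q sin_\<alpha>\<^sub>q cos_double sin_double
          power2_eq_square power3_eq_cube divide_simps)
        (simp_all add: algebra_simps)
    then show ?thesis
      unfolding kb.D_def reflect_def rot_eq
      by (simp only: mat_ring scaleR_add_right scaleR_scaleR)
  qed
  also have "\<dots> = C x ** reflect ?c"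
    unfolding C_eq[OF x] mmult.scaleR_left rot_reflect by (simp add: algebra_simps)
  finally have D: "kb.D = C x ** reflect ?c" .
  have K: "kb.K = C x ** (mat 1 - reflect ?c)"
    unfolding kb.K_def D by (simp add: mat_ring C_def)
  have KU: "kb.K ** U x = C x ** (U x ** (mat 1 - \<Pi>\<^sub>0))"
    by (simp add: K mat_ring reflect_U)
  \<comment> \<open>The angular connection components carry spatial bivectors to the right of
    \<open>K\<close>, while \<open>drift\<close> has them on the left.\<close>
  have K_commute: "kb.K ** gamma2 \<gamma> a b = gamma2 \<gamma> a b ** kb.K" if "a \<noteq> 0" "b \<noteq> 0" for a b
  proof -
    have "gamma2 \<gamma> a b ** C x = C x ** gamma2 \<gamma> a b"
      by (rule C_commute[OF gamma2_gamma5])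
    moreover have "reflect ?c ** gamma2 \<gamma> a b = gamma2 \<gamma> a b ** reflect ?c"
      using that by (intro reflect_commute[symmetric] gamma2_gamma0 gamma2_gamma5)
    ultimately show ?thesis
      unfolding K by (simp add: mat_ring) (simp add: matrix_mul_assoc)
  qed
  have conn: "\<forall>\<mu>. U_deriv x \<mu> + kb.conn \<mu> = drift x \<mu> ** kb.K"
    unfolding all_four
  proof (intro conjI)
    show "U_deriv x 0 + kb.conn 0 = drift x 0 ** kb.K"
      by (simp add: U_deriv_def kb.conn_0 drift_def Let_def mat_ring)
    show "U_deriv x 1 + kb.conn 1 = drift x 1 ** kb.K"
      by (simp add: U_deriv_def kb.conn_1 drift_def Let_def mat_ring K D algebra_simps)
    show "U_deriv x 2 + kb.conn 2 = drift x 2 ** kb.K"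
      unfolding kb.conn_2 gamma2_eq[of 1 2, simplified, symmetric]
      by (simp add: U_deriv_def drift_def Let_def mat_ring K_commute algebra_simps)
    show "U_deriv x 3 + kb.conn 3 = drift x 3 ** kb.K"
      unfolding kb.conn_3 kb.conn_0 gamma2_eq[of 2 3, simplified, symmetric] gamma2_eq[of 1 3, simplified, symmetric]
      by (simp add: U_deriv_def drift_def Let_def mat_ring K_commute algebra_simps)
  qed
  have "((\<lambda>y. U y *v \<eta> y) has_derivative
      (\<lambda>h. U x *v \<eta>' h + (\<Sum>\<mu>\<in>UNIV. h $ \<mu> *\<^sub>R (U_deriv x \<mu> ** U x)) *v \<eta> x)) (at x)"
    by (rule mvmult.FDERIV[OF has_derivative_U[OF x] \<eta>])
  from partial_deriv_eqI[OF this, of \<mu>]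
  have "partial_deriv \<mu> (\<lambda>y. U y *v \<eta> y) x = U x *v \<eta>' (axis \<mu> 1) + (U_deriv x \<mu> ** U x) *v \<eta> x"
    by (simp only: sum_axis_scaleR)
  then have "sugra_deriv \<gamma> (vielbein M N Z) (gauge_potential N Q H) \<mu> (\<lambda>y. U y *v \<eta> y) x
      = U x *v \<eta>' (axis \<mu> 1) + (U_deriv x \<mu> + kb.conn \<mu>) *v (U x *v \<eta> x)"
    unfolding vielbein_eq gauge_potential_eq kb.sugra_deriv_eq
    by (simp add: vec_ring mat_ring)
  also have "(U_deriv x \<mu> + kb.conn \<mu>) *v (U x *v \<eta> x) = (drift x \<mu> ** (kb.K ** U x)) *v \<eta> x"
    using conn by (simp add: matrix_vector_mul_assoc matrix_mul_assoc)
  finally show ?thesis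
    by (simp only: KU matrix_vector_mul_assoc)
qed

end

section \<open>The space of Killing spinors\<close>

text \<open>Derivatives at points of an open set see only the values there; this permits the cut-off
  by zero outside the region and the replacement of a spinor by its gauge-transformed form.\<close>

lemma killing_spinor_on_cong:
  assumes "open S" "\<And>x. x \<in> S \<Longrightarrow> \<epsilon> x = \<epsilon>' x"
  shows "killing_spinor_on \<gamma> e A S \<epsilon> \<longleftrightarrow> killing_spinor_on \<gamma> e A S \<epsilon>'"
proof -
  have iff: "(\<epsilon> has_derivative D) (at x) \<longleftrightarrow> (\<epsilon>' has_derivative D) (at x)" if "x \<in> S" for x D
    using has_derivative_transform_within_open[OF _ assms(1) that, of \<epsilon> D UNIV \<epsilon>']
      has_derivative_transform_within_open[OF _ assms(1) that, of \<epsilon>' D UNIV \<epsilon>] assms(2)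
    by auto
  have "\<epsilon> differentiable (at x) \<longleftrightarrow> \<epsilon>' differentiable (at x)"
    "sugra_deriv \<gamma> e A \<mu> \<epsilon> x = sugra_deriv \<gamma> e A \<mu> \<epsilon>' x" if "x \<in> S" for x \<mu>
    by (simp_all add: differentiable_def sugra_deriv_def partial_deriv_def frechet_derivative_def
        iff[OF that] assms(2)[OF that])
  then show ?thesis
    by (simp add: killing_spinor_on_def)
qed

lemma region_eq: "region M = (\<lambda>x. x $ 1) -` {max M 0<..} \<inter> (\<lambda>x. x $ 2) -` {0<..<pi}"
  by (auto simp: region_def)

lemma open_region: "open (region M)"
  unfolding region_eq by (intro open_Int open_vimage continuous_intros)

lemma convex_region: "convex (region M)"
  unfolding region_eq
  by (intro convex_Int convex_linear_vimage bounded_linear.linear[OF bounded_linear_vec_nth] convex_real_interval)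

lemma region_nonempty: "region M \<noteq> {}"
proof -
  have "(\<chi> i. if i = 1 then max M 0 + 1 else pi / 2) \<in> region M"
    by (auto simp: region_def max_def)
  then show ?thesis
    by blast
qed

lemma linear_zero_on_axes:
  fixes D :: "real^4 \<Rightarrow> 'a::real_normed_vector"
  assumes "linear D" "\<And>\<mu>. D (axis \<mu> 1) = 0"
  shows "D = (\<lambda>_. 0)"
  by (rule linear_eq_stdbasis[OF assms(1)]) (auto simp: linear_iff Basis_vec_def assms(2))

context bps_taub_nut
begin

section \<open>The projection in the ansatz and its range\<close>

definition P :: "complex^4^4" where
  "P = (1/2) *\<^sub>R (rot \<alpha>\<^sub>m + reflect (- \<alpha>\<^sub>q))"

lemma spinor_ansatz_eq: "spinor_ansatz \<gamma> M N \<beta> \<alpha>\<^sub>m \<alpha>\<^sub>q \<epsilon>\<^sub>0 = (\<lambda>x. U x *v (P *v \<epsilon>\<^sub>0))"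
  by (simp add: fun_eq_iff spinor_ansatz_def Let_def U_def theta_rot_def phi_rot_def radial_def P_def
      reflect_def matrix_vector_mul_assoc matrix_mul_assoc)

lemma \<Pi>\<^sub>0_P: "\<Pi>\<^sub>0 ** P = P"
proof -
  have "\<Pi>\<^sub>0 ** rot \<alpha>\<^sub>m = reflect (- \<alpha>\<^sub>q)"
    by (simp add: \<Pi>\<^sub>0_def reflect_rot)
  moreover have "\<Pi>\<^sub>0 = rot \<alpha>\<^sub>m ** reflect (- \<alpha>\<^sub>q)"
    by (simp add: \<Pi>\<^sub>0_def rot_reflect)
  then have "\<Pi>\<^sub>0 ** reflect (- \<alpha>\<^sub>q) = rot \<alpha>\<^sub>m"
    by (simp add: mat_ring reflect_squared)
  ultimately show ?thesis
    by (simp add: P_def mat_ring add.commute)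
qed

text \<open>\<open>P\<close> is in general not idempotent: it is the projector (1 + \<Pi>_0)/2 times
  the invertible rotation \<open>rot \<alpha>\<^sub>m\<close> on its right. Stripping that rotation
  shows that both have the same range.\<close>

lemma P_rot: "P ** rot (- \<alpha>\<^sub>m) = (1/2) *\<^sub>R (mat 1 + \<Pi>\<^sub>0)"
proof -
  have "rot \<alpha>\<^sub>m ** rot (- \<alpha>\<^sub>m) = mat 1"
    unfolding rot_add add.right_inverse by (rule rot_zero)
  moreover have "reflect (- \<alpha>\<^sub>q) ** rot (- \<alpha>\<^sub>m) = \<Pi>\<^sub>0"
    unfolding reflect_rot \<Pi>\<^sub>0_def by simp
  ultimately show ?thesis
    by (simp only: P_def mat_ring)
qed

lemma range_P: "range ((*v) P) = {c. \<Pi>\<^sub>0 *v c = c}"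
proof (intro equalityI subsetI)
  fix c assume "c \<in> {c. \<Pi>\<^sub>0 *v c = c}"
  then have "\<Pi>\<^sub>0 *v c = c"
    by simp
  have "P *v (rot (- \<alpha>\<^sub>m) *v c) = (1/2) *\<^sub>R (c + \<Pi>\<^sub>0 *v c)"
    by (simp only: matrix_vector_mul_assoc P_rot mvmult.scaleR_left mvmult.add_left matrix_vector_mul_lid)
  then have "P *v (rot (- \<alpha>\<^sub>m) *v c) = c"
    unfolding \<open>\<Pi>\<^sub>0 *v c = c\<close> by (simp flip: scaleR_2)
  then show "c \<in> range ((*v) P)"
    by (metis rangeI)
qed (auto simp: matrix_vector_mul_assoc \<Pi>\<^sub>0_P)

lemma killing_spinor_on_U:
  assumes "\<Pi>\<^sub>0 *v c = c"
  shows "killing_spinor_on \<gamma> (vielbein M N Z) (gauge_potential N Q H) (region M) (\<lambda>x. U x *v c)"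
proof -
  have "(mat 1 - \<Pi>\<^sub>0) *v c = 0"
    by (simp add: mvmult.diff_left assms)
  then have "sugra_deriv \<gamma> (vielbein M N Z) (gauge_potential N Q H) \<mu> (\<lambda>x. U x *v c) x = 0"
    if "x \<in> region M" for x \<mu>
    using sugra_deriv_gauge[OF that has_derivative_const, of \<mu> c] by (simp add: mvmult.zero_right)
  moreover have "(\<lambda>x. U x *v c) differentiable (at x)" if "x \<in> region M" for x
    using mvmult.FDERIV[OF has_derivative_U[OF that] has_derivative_const] by (rule differentiableI)
  ultimately show ?thesis
    by (simp add: killing_spinor_on_def)
qed

text \<open>Written out with reversed factors and negated angles, so that its differentiability
  follows from the product rule.\<close>

definition U_inv :: "real^4 \<Rightarrow> complex^4^4" where
  "U_inv y = inverse (sqrt ((y $ 1 - M) / Rad N (y $ 1))) *\<^sub>R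
    (rot (- (\<beta> (y $ 1) / 2)) ** (mat_exp ((- (y $ 3 / 2)) *\<^sub>R \<gamma>23) ** mat_exp ((- (y $ 2 / 2)) *\<^sub>R \<gamma>12)))"

lemma U_inv_U:
  assumes "x \<in> region M"
  shows "U_inv x ** U x = mat 1"
proof -
  have inv: "mat_exp ((- s) *\<^sub>R G) ** mat_exp (s *\<^sub>R G) = mat 1" if "G ** G = - mat 1" for s G
    unfolding mat_exp_add[OF that] add.left_inverse by (rule mat_exp_zero[OF that])
  then have inv_left: "mat_exp ((- s) *\<^sub>R G) ** (mat_exp (s *\<^sub>R G) ** X) = X" if "G ** G = - mat 1" for s G X
    using that by (simp add: matrix_mul_assoc)
  have "sqrt ((x $ 1 - M) / Rad N (x $ 1)) \<noteq> 0"
    using f_pos[of "x $ 1"] f_eq[of "x $ 1"] assms by (auto simp: region_def)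
  then show ?thesis
    by (simp add: U_inv_def U_def theta_rot_def phi_rot_def radial_def mmult.scaleR_left mmult.scaleR_right
        inv inv_left gamma2_squared gamma5_squared del: scaleR_minus_left
        flip: matrix_mul_assoc)
qed

lemma U_U_inv: "x \<in> region M \<Longrightarrow> U x ** U_inv x = mat 1"
  using U_inv_U matrix_left_right_inverse by blast

lemma differentiable_U_inv:
  assumes x: "x \<in> region M"
  shows "U_inv differentiable (at x)"
proof -
  have "sqrt ((x $ 1 - M) / Rad N (x $ 1)) \<noteq> 0"
    using f_pos[of "x $ 1"] f_eq[of "x $ 1"] assms by (auto simp: region_def)
  note 1 = Deriv.has_derivative_inverse[OF this has_derivative_radial_factors(1)[OF x]]
  note 2 = has_derivative_mat_exp[OF gamma5_squared has_derivative_minus[OF has_derivative_radial_factors(2)[OF x]]]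
  have c: "((\<lambda>y. - (y $ i / 2)) has_derivative (\<lambda>h. - (h $ i / 2))) (at x)" for i :: 4
    using has_derivative_coordinate[OF DERIV_cdivide[OF DERIV_ident, of 2], where x = x and i = i]
    by (intro has_derivative_minus) simp
  note 3 = has_derivative_mat_exp[OF gamma2_squared c[of 3], of 2 3]
  note 4 = has_derivative_mat_exp[OF gamma2_squared c[of 2], of 1 2]
  show ?thesis
    unfolding U_inv_def[abs_def]
    by (rule differentiableI[OF has_derivative_scaleR[OF 1 mmult.FDERIV[OF 2 mmult.FDERIV[OF 3 4]]]]) simp_all
qed

text \<open>J exchanges the eigenspaces of \<Pi>_0, so the J-part of \<open>C\<close> dies between
  the two factors. The factor 2 appears because 1 - \<Pi>_0 is twice a projector.\<close>

lemma \<Pi>\<^sub>0_C_\<Pi>\<^sub>0: "(mat 1 - \<Pi>\<^sub>0) ** (C x ** (mat 1 - \<Pi>\<^sub>0)) = (2 * p (x $ 1)) *\<^sub>R (mat 1 - \<Pi>\<^sub>0)"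
proof -
  have J: "\<Pi>\<^sub>0 ** J = - (J ** \<Pi>\<^sub>0)" "\<Pi>\<^sub>0 ** \<Pi>\<^sub>0 = mat 1"
    by (simp_all add: \<Pi>\<^sub>0_def reflect_gamma5 reflect_squared)
  then have "\<Pi>\<^sub>0 ** (J ** \<Pi>\<^sub>0) = - J"
    by (metis matrix_mul_assoc matrix_mul_rid mmult.minus_left)
  with J show ?thesis
    by (simp only: C_def mat_ring) (simp add: vec_eq_iff scaleR_conv_of_real algebra_simps)
qed

text \<open>The displacement is taken nonnegative so that r + s stays in the region.\<close>

lemma p_not_constant:
  assumes "r > 0"
  obtains s where "s \<ge> 0" "p (r + s) \<noteq> p r"
proof (rule ccontr)
  assume *: "\<not> thesis"
  note witness = that
  have "(r + s) * M + N\<^sup>2 = p r * ((r + s)\<^sup>2 + N\<^sup>2)" if "s \<ge> 0" for s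
  proof -
    have "p (r + s) = p r"
      using * witness that by blast
    moreover have "(r + s)\<^sup>2 + N\<^sup>2 > 0"
      using assms that by (simp add: add_pos_nonneg)
    then have "p (r + s) * ((r + s)\<^sup>2 + N\<^sup>2) = (r + s) * M + N\<^sup>2"
      by (simp add: p_def Rad_squared)
    ultimately show ?thesis
      by simp
  qed
  \<comment> \<open>Constancy would make an affine function of s equal to \<open>p r\<close> times a
    quadratic one. The second difference at 0, 1, 2 leaves 2 p(r) = 0, and then M = N = 0, against Z
    > 0.\<close>
  from this[of 0] this[of 1] this[of 2]
  have eqs: "r * M + N\<^sup>2 = p r * (r\<^sup>2 + N\<^sup>2)" "(r + 1) * M + N\<^sup>2 = p r * ((r + 1)\<^sup>2 + N\<^sup>2)"
    "(r + 2) * M + N\<^sup>2 = p r * ((r + 2)\<^sup>2 + N\<^sup>2)"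
    by simp_all
  then have "p r * ((r + 2)\<^sup>2 + N\<^sup>2) - 2 * (p r * ((r + 1)\<^sup>2 + N\<^sup>2)) + p r * (r\<^sup>2 + N\<^sup>2) = 0"
    by (simp flip: eqs) (simp add: algebra_simps)
  then have "p r = 0"
    by (simp add: power2_eq_square algebra_simps)
  with eqs have "M = 0" "N = 0"
    by (auto simp: algebra_simps)
  then show False
    using mass_BPS Z_pos by simp
qed

end

section \<open>Excluding further Killing spinors\<close>

context bps_taub_nut
begin

definition phi_inv :: "real^4 \<Rightarrow> complex^4^4" where
  "phi_inv y = mat_exp ((- (y $ 3 / 2)) *\<^sub>R \<gamma>23)"

text \<open>This is U^-1 \<gamma>_12 U: the \<theta>-rotation commutes with \<gamma>_12 and the
  radial factor with the remaining conjugate, so only \<phi> is left as a variable.\<close>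

definition \<sigma> :: "real^4 \<Rightarrow> complex^4^4" where
  "\<sigma> y = phi_inv y ** (\<gamma>12 ** phi_rot y)"

lemma phi_rot_inverse: "phi_inv y ** phi_rot y = mat 1" "phi_rot y ** phi_inv y = mat 1"
proof -
  have G: "\<gamma>23 ** \<gamma>23 = - mat 1"
    by (simp add: gamma2_squared)
  show "phi_inv y ** phi_rot y = mat 1" "phi_rot y ** phi_inv y = mat 1"
    unfolding phi_rot_def phi_inv_def mat_exp_add[OF G] add.left_inverse add.right_inverse
    by (rule mat_exp_zero[OF G])+
qed

lemma phi_rot_inverse_left: "phi_rot y ** (phi_inv y ** X) = X"
  by (simp add: matrix_mul_assoc phi_rot_inverse)

lemma \<sigma>_commute:
  assumes "X ** \<gamma>12 = \<gamma>12 ** X" "X ** \<gamma>23 = \<gamma>23 ** X"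
  shows "X ** \<sigma> y = \<sigma> y ** X"
proof -
  have "X ** mat_exp (s *\<^sub>R \<gamma>23) = mat_exp (s *\<^sub>R \<gamma>23) ** X" for s
    using assms(2) by (intro mat_exp_commute gamma2_squared) simp_all
  with assms(1) show ?thesis
    unfolding \<sigma>_def phi_rot_def phi_inv_def by (metis (no_types) matrix_mul_assoc)
qed

lemma \<sigma>_injective: "\<sigma> y *v c = 0 \<Longrightarrow> c = 0"
proof -
  assume "\<sigma> y *v c = 0"
  have "\<sigma> y ** \<sigma> y = - mat 1"
    unfolding \<sigma>_def
    by (simp only: matrix_mul_assoc[symmetric] phi_rot_inverse_left)
      (simp add: matrix_mul_assoc[of \<gamma>12 \<gamma>12] gamma2_squared mmult.minus_left mmult.minus_right phi_rot_inverse)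
  then have "\<sigma> y *v (\<sigma> y *v c) = - c"
    by (simp add: matrix_vector_mul_assoc mvmult.minus_left)
  with \<open>\<sigma> y *v c = 0\<close> show "c = 0"
    by (simp add: mvmult.zero_right)
qed

lemma gamma12_U: "\<gamma>12 ** U x = U x ** \<sigma> x"
proof -
  have "\<gamma>12 ** theta_rot x = theta_rot x ** \<gamma>12"
    unfolding theta_rot_def by (intro mat_exp_commute gamma2_squared) simp_all
  moreover have "J ** \<sigma> x = \<sigma> x ** J"
    by (intro \<sigma>_commute) (simp_all add: gamma2_gamma5)
  then have "\<sigma> x ** rot s = rot s ** \<sigma> x" for s
    by (intro rot_commute) simp
  then have "radial x ** \<sigma> x = \<sigma> x ** radial x"
    by (simp add: radial_def mat_ring)
  moreover have "phi_rot x ** \<sigma> x = \<gamma>12 ** phi_rot x"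
    unfolding \<sigma>_def by (rule phi_rot_inverse_left)
  ultimately show ?thesis
    unfolding U_def by (metis (no_types) matrix_mul_assoc)
qed

lemma U_C: "U x ** C x = C x ** U x"
  by (rule C_commute) (metis (no_types) U_def commute_gamma5(1-3) matrix_mul_assoc)

lemma U_cancel: "x \<in> region M \<Longrightarrow> U x *v a = U x *v b \<Longrightarrow> a = b"
  by (metis U_inv_U matrix_vector_mul_assoc matrix_vector_mul_lid)

lemma killing_spinor_imp_constant:
  assumes kill: "killing_spinor_on \<gamma> (vielbein M N Z) (gauge_potential N Q H) (region M) \<epsilon>"
  obtains c where "\<Pi>\<^sub>0 *v c = c" "\<And>x. x \<in> region M \<Longrightarrow> \<epsilon> x = U x *v c"
proof -
  define \<eta> where "\<eta> y = U_inv y *v \<epsilon> y" for y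
  define D where "D x = frechet_derivative \<eta> (at x)" for x
  define \<xi> where "\<xi> y = (mat 1 - \<Pi>\<^sub>0) *v \<eta> y" for y
  have \<epsilon>_eq: "\<epsilon> x = U x *v \<eta> x" if "x \<in> region M" for x
    by (simp add: \<eta>_def matrix_vector_mul_assoc U_U_inv[OF that])
  have D: "(\<eta> has_derivative D x) (at x)" if "x \<in> region M" for x
  proof -
    have "U_inv differentiable (at x)" "\<epsilon> differentiable (at x)"
      using differentiable_U_inv kill that by (auto simp: killing_spinor_on_def)
    then obtain A B where "(U_inv has_derivative A) (at x)" "(\<epsilon> has_derivative B) (at x)"
      unfolding differentiable_def by blast
    from mvmult.FDERIV[OF this] have "\<eta> differentiable (at x)"
      unfolding \<eta>_def[abs_def] by (rule differentiableI)
    then show ?thesis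
      by (simp add: D_def frechet_derivative_works)
  qed
  have "killing_spinor_on \<gamma> (vielbein M N Z) (gauge_potential N Q H) (region M) (\<lambda>x. U x *v \<eta> x)"
    using killing_spinor_on_cong[OF open_region, of M \<epsilon> "\<lambda>x. U x *v \<eta> x"] \<epsilon>_eq kill by simp
  then have gauge: "U x *v D x (axis \<mu> 1) + drift x \<mu> *v (C x *v (U x *v \<xi> x)) = 0"
    if "x \<in> region M" for x \<mu>
    using sugra_deriv_gauge[OF that D[OF that]] that by (simp add: killing_spinor_on_def \<xi>_def)
  have CU: "C x *v (U x *v a) = U x *v (C x *v a)" for x a
    by (simp add: matrix_vector_mul_assoc U_C)
  have \<Pi>C\<xi>: "(mat 1 - \<Pi>\<^sub>0) *v (C x *v \<xi> x) = (2 * p (x $ 1)) *\<^sub>R \<xi> x" for x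
    by (simp add: \<xi>_def matrix_vector_mul_assoc \<Pi>\<^sub>0_C_\<Pi>\<^sub>0 flip: mvmult.scaleR_left)
  \<comment> \<open>Unprojected, the r-equation mixes the eigenspaces through the J-part of
    \<open>C\<close>; applying 1 - \<Pi>_0 yields an equation for \<xi> alone.\<close>
  have D1: "(mat 1 - \<Pi>\<^sub>0) *v D x (axis 1 1) = - ((p (x $ 1) / (Rad N (x $ 1) * f (x $ 1))) *\<^sub>R \<xi> x)"
    if "x \<in> region M" for x
  proof -
    let ?k = "1 / (2 * Rad N (x $ 1) * f (x $ 1))"
    have "U x *v D x (axis 1 1) + ?k *\<^sub>R (U x *v (C x *v \<xi> x)) = 0"
      using gauge[OF that, of 1] by (simp add: drift_def Let_def CU mvmult.scaleR_left)
    then have "U x *v D x (axis 1 1) = U x *v (- (?k *\<^sub>R (C x *v \<xi> x)))"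
      by (simp add: eq_neg_iff_add_eq_0 mvmult.minus_right mvmult.scaleR_right)
    then have "D x (axis 1 1) = - (?k *\<^sub>R (C x *v \<xi> x))"
      by (rule U_cancel[OF that])
    then show ?thesis
      by (simp add: mvmult.minus_right mvmult.scaleR_right \<Pi>C\<xi>)
  qed
  \<comment> \<open>The bivectors in \<sigma> commute with \<gamma>_0 and J, so the projection
    passes through \<sigma> and the \<theta>-equation closes on \<xi> as well.\<close>
  have \<Pi>\<sigma>: "(mat 1 - \<Pi>\<^sub>0) ** \<sigma> x = \<sigma> x ** (mat 1 - \<Pi>\<^sub>0)" for x
  proof (rule \<sigma>_commute)
    have "gamma2 \<gamma> a b ** \<Pi>\<^sub>0 = \<Pi>\<^sub>0 ** gamma2 \<gamma> a b" if "a \<noteq> 0" "b \<noteq> 0" for a b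
      unfolding \<Pi>\<^sub>0_def using that by (intro reflect_commute gamma2_gamma0 gamma2_gamma5)
    then show "(mat 1 - \<Pi>\<^sub>0) ** \<gamma>12 = \<gamma>12 ** (mat 1 - \<Pi>\<^sub>0)" "(mat 1 - \<Pi>\<^sub>0) ** \<gamma>23 = \<gamma>23 ** (mat 1 - \<Pi>\<^sub>0)"
      by (simp_all add: mat_ring)
  qed
  have D2: "(mat 1 - \<Pi>\<^sub>0) *v D x (axis 2 1) = - (p (x $ 1) *\<^sub>R (\<sigma> x *v \<xi> x))"
    if "x \<in> region M" for x
  proof -
    have "\<gamma>12 *v (U x *v a) = U x *v (\<sigma> x *v a)" for a
      by (simp add: matrix_vector_mul_assoc gamma12_U)
    then have "U x *v D x (axis 2 1) + (1/2) *\<^sub>R (U x *v (\<sigma> x *v (C x *v \<xi> x))) = 0"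
      using gauge[OF that, of 2] by (simp add: drift_def Let_def CU mvmult.scaleR_left)
    then have "U x *v D x (axis 2 1) = U x *v (- ((1/2) *\<^sub>R (\<sigma> x *v (C x *v \<xi> x))))"
      by (simp add: eq_neg_iff_add_eq_0 mvmult.minus_right mvmult.scaleR_right)
    then have "D x (axis 2 1) = - ((1/2) *\<^sub>R (\<sigma> x *v (C x *v \<xi> x)))"
      by (rule U_cancel[OF that])
    moreover have "(mat 1 - \<Pi>\<^sub>0) *v (\<sigma> x *v (C x *v \<xi> x)) = \<sigma> x *v ((mat 1 - \<Pi>\<^sub>0) *v (C x *v \<xi> x))"
      by (simp only: matrix_vector_mul_assoc matrix_mul_assoc \<Pi>\<sigma>)
    ultimately show ?thesis
      by (simp add: mvmult.minus_right mvmult.scaleR_right \<Pi>C\<xi>)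
  qed
  \<comment> \<open>The weight is an integrating factor: f' = p/R cancels the coefficient -p/(R f)
    in \<open>D1\<close>.\<close>
  define w where "w y = f (y $ 1) *\<^sub>R \<xi> y" for y
  define Dw where "Dw x h = f (x $ 1) *\<^sub>R ((mat 1 - \<Pi>\<^sub>0) *v D x h)
    + (p (x $ 1) / Rad N (x $ 1) * h $ 1) *\<^sub>R \<xi> x" for x h
  have Dw: "(w has_derivative Dw x) (at x)" if "x \<in> region M" for x
  proof -
    have "x $ 1 > max M 0"
      using that by (simp add: region_def)
    from has_derivative_coordinate[OF DERIV_f[OF this]]
    have "((\<lambda>y. f (y $ 1)) has_derivative (\<lambda>h. p (x $ 1) / Rad N (x $ 1) * h $ 1)) (at x)" .
    moreover have "(\<xi> has_derivative (\<lambda>h. (mat 1 - \<Pi>\<^sub>0) *v D x h)) (at x)"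
      unfolding \<xi>_def[abs_def] by (rule bounded_linear.has_derivative[OF mvmult.bounded_linear_right D[OF that]])
    ultimately show ?thesis
      unfolding w_def[abs_def] Dw_def[abs_def] by (rule has_derivative_scaleR)
  qed
  have Dw1: "Dw x (axis 1 1) = 0" if "x \<in> region M" for x
    using D1[OF that] f_pos[of "x $ 1"] that by (simp add: Dw_def axis_def region_def)
  have Dw2: "Dw x (axis 2 1) = - (p (x $ 1) *\<^sub>R (\<sigma> x *v w x))" if "x \<in> region M" for x
    using D2[OF that] by (simp add: Dw_def w_def axis_def mvmult.scaleR_right mult.commute)
  \<comment> \<open>The region is unbounded to larger r, so outward radial segments stay inside
    it.\<close>
  have in_region: "x + t *\<^sub>R axis 1 1 \<in> region M" if "x \<in> region M" "t \<ge> 0" for x t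
    using that by (simp add: region_def axis_def)
  have shift: "w (x + s *\<^sub>R axis 1 1) = w x" if "x \<in> region M" "s \<ge> 0" for x s
  proof -
    have "((\<lambda>t. w (x + t *\<^sub>R axis 1 1)) has_derivative (\<lambda>_. 0)) (at t within {0..s})" if "t \<in> {0..s}" for t
    proof -
      have t: "x + t *\<^sub>R axis 1 1 \<in> region M"
        using in_region[OF \<open>x \<in> region M\<close>] that by simp
      have "((\<lambda>t. x + t *\<^sub>R axis 1 1) has_derivative (\<lambda>t. t *\<^sub>R axis 1 1)) (at t within {0..s})"
        by (auto intro!: derivative_eq_intros)
      from has_derivative_compose[OF this Dw[OF t]] show ?thesis
        by (simp add: linear_scale[OF has_derivative_linear[OF Dw[OF t]]] Dw1[OF t])
    qed
    from has_derivative_zero_constant[OF convex_real_interval(5) this]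
    obtain c where "w (x + t *\<^sub>R axis 1 1) = c" if "t \<in> {0..s}" for t
      by blast
    from this[of 0] this[of s] \<open>s \<ge> 0\<close> show ?thesis
      by simp
  qed
  have \<xi>0: "\<xi> x = 0" if x: "x \<in> region M" for x
  proof -
    have "x $ 1 > 0"
      using x by (simp add: region_def)
    then obtain s where s: "s \<ge> 0" "p (x $ 1 + s) \<noteq> p (x $ 1)"
      using p_not_constant by blast
    let ?x = "x + s *\<^sub>R axis 1 1"
    have x': "?x \<in> region M"
      by (rule in_region[OF x s(1)])
    \<comment> \<open>The identity w(y + s e_r) = w(y) holds throughout the open region, so it may
      be differentiated in every direction. Its \<theta>-component equates p \<sigma> w at the two
      radii, where \<sigma> and w agree but p does not.\<close>
    have "((\<lambda>y. y + s *\<^sub>R axis 1 1) has_derivative (\<lambda>h. h)) (at x)"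
      by (auto intro!: derivative_eq_intros)
    from has_derivative_compose[OF this Dw[OF x']]
    have "((\<lambda>y. w (y + s *\<^sub>R axis 1 1)) has_derivative Dw ?x) (at x)" .
    then have "(w has_derivative Dw ?x) (at x)"
      by (rule has_derivative_transform_within_open[OF _ open_region x]) (rule shift[OF _ s(1)])
    then have "Dw ?x = Dw x"
      by (rule has_derivative_unique[OF _ Dw[OF x]])
    then have "p (?x $ 1) *\<^sub>R (\<sigma> ?x *v w ?x) = p (x $ 1) *\<^sub>R (\<sigma> x *v w x)"
      using Dw2[OF x] Dw2[OF x'] by simp
    moreover have "\<sigma> ?x = \<sigma> x" "?x $ 1 = x $ 1 + s"
      by (simp_all add: \<sigma>_def phi_rot_def phi_inv_def axis_def)
    ultimately have "(p (x $ 1 + s) - p (x $ 1)) *\<^sub>R (\<sigma> x *v w x) = 0"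
      by (simp add: shift[OF x s(1)] scaleR_left_diff_distrib)
    then have "\<sigma> x *v w x = 0"
      using s(2) by simp
    then have "w x = 0"
      by (rule \<sigma>_injective)
    then show ?thesis
      using f_pos[of "x $ 1"] x by (simp add: w_def region_def)
  qed
  have "D x = (\<lambda>_. 0)" if "x \<in> region M" for x
  proof (rule linear_zero_on_axes[OF has_derivative_linear[OF D[OF that]]])
    \<comment> \<open>With \<xi> = 0 the drift term drops out of all four equations; convexity of
      the region then gives a global constant.\<close>
    have "U x *v D x (axis \<mu> 1) = U x *v 0" for \<mu>
      using gauge[OF that, of \<mu>] by (simp add: \<xi>0[OF that] mvmult.zero_right)
    then show "D x (axis \<mu> 1) = 0" for \<mu>
      by (rule U_cancel[OF that])
  qed
  then have "(\<eta> has_derivative (\<lambda>_. 0)) (at x within region M)" if "x \<in> region M" for x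
    using has_derivative_at_withinI[OF D[OF that]] that by simp
  from has_derivative_zero_constant[OF convex_region this]
  obtain c where c: "\<eta> x = c" if "x \<in> region M" for x
    by blast
  show thesis
  proof (rule that)
    obtain x where x: "x \<in> region M"
      using region_nonempty by blast
    from \<xi>0[OF x] c[OF x] show "\<Pi>\<^sub>0 *v c = c"
      by (simp add: \<xi>_def mvmult.diff_left)
    show "\<epsilon> x = U x *v c" if "x \<in> region M" for x
      using \<epsilon>_eq[OF that] c[OF that] by simp
  qed
qed

section \<open>Dimension of the space of Killing spinors\<close>

definition U_field :: "complex^4 \<Rightarrow> real^4 \<Rightarrow> complex^4" where
  "U_field c = field_on (region M) (\<lambda>x. U x *v c)"

lemma killing_spinors_eq:
  "killing_spinors \<gamma> (vielbein M N Z) (gauge_potential N Q H) (region M) = U_field ` {c. \<Pi>\<^sub>0 *v c = c}"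
proof (intro equalityI subsetI)
  fix \<epsilon> assume "\<epsilon> \<in> killing_spinors \<gamma> (vielbein M N Z) (gauge_potential N Q H) (region M)"
  then have "killing_spinor_on \<gamma> (vielbein M N Z) (gauge_potential N Q H) (region M) \<epsilon>"
    and "\<And>x. x \<notin> region M \<Longrightarrow> \<epsilon> x = 0"
    by (auto simp: killing_spinors_def)
  moreover obtain c where "\<Pi>\<^sub>0 *v c = c" "\<And>x. x \<in> region M \<Longrightarrow> \<epsilon> x = U x *v c"
    using killing_spinor_imp_constant[OF calculation(1)] by blast
  ultimately have "\<epsilon> = U_field c" "\<Pi>\<^sub>0 *v c = c"
    by (auto simp: U_field_def field_on_def)
  then show "\<epsilon> \<in> U_field ` {c. \<Pi>\<^sub>0 *v c = c}"
    by blast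
next
  fix \<epsilon> assume "\<epsilon> \<in> U_field ` {c. \<Pi>\<^sub>0 *v c = c}"
  then obtain c where c: "\<Pi>\<^sub>0 *v c = c" "\<epsilon> = U_field c"
    by blast
  then show "\<epsilon> \<in> killing_spinors \<gamma> (vielbein M N Z) (gauge_potential N Q H) (region M)"
    using killing_spinor_on_U[OF c(1)]
      killing_spinor_on_cong[OF open_region, of M \<epsilon> "\<lambda>x. U x *v c" \<gamma> "vielbein M N Z" "gauge_potential N Q H"]
    by (simp add: killing_spinors_def U_field_def field_on_def)
qed

lemma range_field_on_spinor_ansatz:
  "range (\<lambda>\<epsilon>\<^sub>0. field_on (region M) (spinor_ansatz \<gamma> M N \<beta> \<alpha>\<^sub>m \<alpha>\<^sub>q \<epsilon>\<^sub>0)) = U_field ` {c. \<Pi>\<^sub>0 *v c = c}"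
  unfolding spinor_ansatz_eq range_P[symmetric] U_field_def by (simp add: image_image)

text \<open>\<open>U_field\<close> is linear, and its value at a single point of the region already
  determines c because U is invertible there. The dimension of the eigenspace is thus carried over
  to the function space.\<close>

lemma dim_U_field: "vector_space.dim spinor_scale (U_field ` {c. \<Pi>\<^sub>0 *v c = c}) = 2"
proof -
  interpret spinor: vector_space spinor_scale
    by (rule vector_space_spinor_scale)
  \<comment> \<open>Only the source \<open>complex^4\<close> is finite-dimensional; the target is
    the space of all spinor fields.\<close>
  interpret pair: finite_dimensional_vector_space_pair_1 "(*s)" cart_basis spinor_scale ..
  have "Vector_Spaces.linear (*s) spinor_scale U_field"
    by unfold_locales
      (auto simp: U_field_def field_on_def spinor_scale_def fun_eq_iff mvmult.add_right matrix_scale_commute)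
  moreover have "inj U_field"
  proof (rule injI)
    fix c d assume *: "U_field c = U_field d"
    obtain x where x: "x \<in> region M"
      using region_nonempty by blast
    with fun_cong[OF *, of x] have "U x *v c = U x *v d"
      by (simp add: U_field_def field_on_def)
    then show "c = d"
      by (rule U_cancel[OF x])
  qed
  ultimately have "spinor.dim (U_field ` {c. \<Pi>\<^sub>0 *v c = c}) = vec.dim {c. \<Pi>\<^sub>0 *v c = c}"
    using pair.dim_image_eq inj_on_subset[OF _ subset_UNIV] by blast
  then show ?thesis
    by (simp add: \<Pi>\<^sub>0_def dim_reflect_eigenspace)
qed

end

theorem mainTheorem7:
  fixes M N Q H Z :: real
    and \<gamma> :: "4 \<Rightarrow> complex^4^4"
    and \<beta> :: "real \<Rightarrow> real"
    and \<alpha>\<^sub>m \<alpha>\<^sub>q :: real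
  assumes "Z > 0"
    and "M^2 + N^2 = Z^2"
    and "Q^2 + H^2 = Z^2"
    and "real_gamma_matrices \<gamma>"
    and "\<And>r. r > max M 0 \<Longrightarrow>
           - pi / 2 < \<beta> r \<and> \<beta> r < pi / 2 \<and> cos (\<beta> r) = r / Rad N r \<and> sin (\<beta> r) = N / Rad N r"
    and "cos \<alpha>\<^sub>m = M / sqrt (M^2 + N^2)" and "sin \<alpha>\<^sub>m = N / sqrt (M^2 + N^2)"
    and "cos \<alpha>\<^sub>q = Q / Z" and "sin \<alpha>\<^sub>q = H / Z"
  shows "(\<forall>\<epsilon>\<^sub>0. killing_spinor_on \<gamma> (vielbein M N Z) (gauge_potential N Q H) (region M)
                (spinor_ansatz \<gamma> M N \<beta> \<alpha>\<^sub>m \<alpha>\<^sub>q \<epsilon>\<^sub>0))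
    \<and> vector_space.dim spinor_scale
        (range (\<lambda>\<epsilon>\<^sub>0. field_on (region M) (spinor_ansatz \<gamma> M N \<beta> \<alpha>\<^sub>m \<alpha>\<^sub>q \<epsilon>\<^sub>0))) = 2
    \<and> vector_space.dim spinor_scale
        (killing_spinors \<gamma> (vielbein M N Z) (gauge_potential N Q H) (region M)) = 2"
proof -
  have Z: "sqrt (M^2 + N^2) = Z"
    using assms(1,2) by simp
  interpret bps_taub_nut \<gamma> M N Q H Z \<beta> \<alpha>\<^sub>m \<alpha>\<^sub>q
  proof
    show "\<gamma> a ** \<gamma> b + \<gamma> b ** \<gamma> a = mat (complex_of_real (2 * eta a b))" for a b
      using assms(4) by (simp add: real_gamma_matrices_def)
  qed (use assms(1,2,5-9) Z in simp_all)
  have "\<Pi>\<^sub>0 *v (P *v \<epsilon>\<^sub>0) = P *v \<epsilon>\<^sub>0" for \<epsilon>\<^sub>0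
    by (simp add: matrix_vector_mul_assoc \<Pi>\<^sub>0_P)
  then show ?thesis
    unfolding range_field_on_spinor_ansatz killing_spinors_eq dim_U_field
    by (simp add: spinor_ansatz_eq killing_spinor_on_U)
qed

end
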